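(* For every $n\in\{2,3,4,\dots\}$, $C^*_\lambda(F_n)$ is completely isomorphic to $C^*_\lambda(F_\infty)$; that is, there is a linear bijection $u:C^*_\lambda(F_n)\to C^*_\lambda(F_\infty)$ such that $u$ and $u^{-1}$ are completely bounded.
   Context: For a discrete group $G$, let $\ell_2(G)$ have orthonormal basis $\{\delta_x\}$, $\lambda(x)\delta_y=\delta_{xy}$ the left regular representation, and $C^*_\lambda(G)$ the norm closure of $\mathrm{span}\{\lambda(x):x\in G\}$ in $B(\ell_2(G))$. $F_n$ is the free group on $n$ generators, $F_\infty$ the free group on countably infinitely many generators. A linear map $u$ between operator spaces is completely bounded if $\sup_k\|u_k\|<\infty$, where $u_k$ acts entrywise on $k\times k$ matrices normed via $M_k(B(H))=B(H^k)$. *)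

theory Defs
  imports "HOL-Analysis.Analysis"
begin

text \<open>A letter (a, True) is the generator a, (a, False) its inverse.
  Group elements of the free group on a set of generators are the reduced words.\<close>

type_synonym word = "(nat \<times> bool) list"

fun reduced :: "word \<Rightarrow> bool" where
  "reduced (x # y # ys) = (\<not> (fst x = fst y \<and> snd x \<noteq> snd y) \<and> reduced (y # ys))"
| "reduced _ = True"

fun cons_red :: "nat \<times> bool \<Rightarrow> word \<Rightarrow> word" where
  "cons_red x (y # ys) = (if fst x = fst y \<and> snd x \<noteq> snd y then ys else x # y # ys)"
| "cons_red x [] = [x]"

definition wmult :: "word \<Rightarrow> word \<Rightarrow> word" where
  "wmult xs ys = foldr cons_red xs ys"

definition winv :: "word \<Rightarrow> word" where
  "winv xs = rev (map (\<lambda>(a, b). (a, \<not> b)) xs)"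

definition free_grp :: "nat set \<Rightarrow> word set" where
  "free_grp S = {w. reduced w \<and> (\<forall>x\<in>set w. fst x \<in> S)}"

abbreviation F_fin :: "nat \<Rightarrow> word set" where "F_fin n \<equiv> free_grp {..<n}"
abbreviation F_inf :: "word set" where "F_inf \<equiv> free_grp UNIV"

type_synonym vec = "word \<Rightarrow> complex"
type_synonym op = "vec \<Rightarrow> vec"

definition l2 :: "word set \<Rightarrow> vec set" where
  "l2 G = {f. (\<forall>x. x \<notin> G \<longrightarrow> f x = 0) \<and> (\<lambda>x. (cmod (f x))^2) summable_on G}"

definition l2norm :: "word set \<Rightarrow> vec \<Rightarrow> real" where
  "l2norm G f = sqrt (infsum (\<lambda>x. (cmod (f x))^2) G)"

definition Bop :: "word set \<Rightarrow> op set" where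
  "Bop G = {T. (\<forall>f. f \<notin> l2 G \<longrightarrow> T f = (\<lambda>_. 0))
     \<and> (\<forall>f\<in>l2 G. T f \<in> l2 G)
     \<and> (\<forall>f\<in>l2 G. \<forall>g\<in>l2 G. \<forall>c::complex. T (\<lambda>x. c * f x + g x) = (\<lambda>x. c * T f x + T g x))
     \<and> (\<exists>C. \<forall>f\<in>l2 G. l2norm G (T f) \<le> C * l2norm G f)}"

definition opnorm :: "word set \<Rightarrow> op \<Rightarrow> real" where
  "opnorm G T = Sup {l2norm G (T f) | f. f \<in> l2 G \<and> l2norm G f \<le> 1}"

definition lreg :: "word set \<Rightarrow> word \<Rightarrow> op" where
  "lreg G x f = (if f \<in> l2 G then (\<lambda>z. if z \<in> G then f (wmult (winv x) z) else 0) else (\<lambda>_. 0))"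

definition Cred :: "word set \<Rightarrow> op set" where
  "Cred G = {T \<in> Bop G. \<forall>e>0. \<exists>F a. finite F \<and> F \<subseteq> G \<and>
      opnorm G (\<lambda>f z. T f z - (\<Sum>x\<in>F. a x * lreg G x f z)) < e}"

definition matnorm :: "word set \<Rightarrow> nat \<Rightarrow> (nat \<Rightarrow> nat \<Rightarrow> op) \<Rightarrow> real" where
  "matnorm G k M = Sup {sqrt (\<Sum>i<k. (l2norm G (\<lambda>z. \<Sum>j<k. M i j (fs j) z))^2) | fs.
       (\<forall>j<k. fs j \<in> l2 G) \<and> (\<Sum>j<k. (l2norm G (fs j))^2) \<le> 1}"

definition lin_on :: "op set \<Rightarrow> (op \<Rightarrow> op) \<Rightarrow> bool" where
  "lin_on A u = (\<forall>S\<in>A. \<forall>T\<in>A. \<forall>c::complex.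
      u (\<lambda>f x. c * S f x + T f x) = (\<lambda>f x. c * u S f x + u T f x))"

definition cbounded :: "word set \<Rightarrow> word set \<Rightarrow> (op \<Rightarrow> op) \<Rightarrow> bool" where
  "cbounded G H u = (\<exists>C. \<forall>k M. (\<forall>i<k. \<forall>j<k. M i j \<in> Cred G) \<longrightarrow>
      matnorm H k (\<lambda>i j. u (M i j)) \<le> C * matnorm G k M)"

end

theory Submission
  imports Defs
begin

text \<open>
  There is a bijection between the two free groups whose linear extension
  \<open>\<lambda>(x) \<mapsto> \<lambda>(\<phi>(x))\<close> is completely bounded in both directions. It comes from Pelczynski's
  decomposition method, carried out on the group elements. Let \<open>G\<close> and \<open>K\<close> be free groups of rank at
  least two, possibly infinite. Embed \<open>K\<close> into \<open>G\<close> and choose elements \<open>h\<^sub>0, h\<^sub>1, \<dots>\<close> of \<open>G\<close>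
  that are free from one another and from \<open>K\<close>. On the cosets \<open>h\<^sub>m K\<close> an operator
  \<open>\<Sum> \<lambda>(h\<^sub>m) a\<^sub>m\<close> has norm comparable to the maximum of \<open>\<parallel>\<Sum> a\<^sub>m\<^sup>* a\<^sub>m\<parallel>\<^sup>1\<^sup>/\<^sup>2\<close> and an \<open>\<ell>\<^sub>2\<close>
  row norm of all coefficients; these quantities do not change when the indices \<open>m\<close> are shifted, and
  they are bounded by the norm of any operator with these coefficients. Shifting by one frees the
  coset \<open>h\<^sub>0 K\<close> for a copy of \<open>K\<close>, so that \<open>C\<^sup>*(G) \<cong> C\<^sup>*(G) \<oplus> C\<^sup>*(K)\<close>. Exchanging the roles of
  \<open>G\<close> and \<open>K\<close> gives \<open>C\<^sup>*(G) \<cong> C\<^sup>*(K)\<close>.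
\<close>

section \<open>Bounded block matrices\<close>

text \<open>Free groups of different ranks are not isomorphic, so the bijection cannot be
  multiplicative in general and everything rests on norm estimates. The two norms on the cosets come
  from ping-pong. For a fixed reduced word y, at most one element h_m x fails to move y, by left
  multiplication, into the words beginning with the prefix b^(2m) a of h_m. The regular entries
  split by m into disjoint sets of rows, hence a column estimate; an exceptional entry occurs at
  most once per column, hence a row estimate. Both norms are norms of submatrices of the full
  matrix, so cutting an operator down to the cosets costs a constant. The conjugates b^j a b^-j are
  used because two generators must already supply an infinite free family; the parity of j separates
  the h_m from the embedded group. The number D always bounds the square of a norm. Adding two
  matrices turns D and D' into 2D + 2D', which produces every constant up to 1456 = 28 * 52. No
  constant depends on the block size k. Since tests use finite vectors, convergence enters when
  matrices become operators.\<close>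

text \<open>
  The block matrix with the \<open>k \<times> k\<close> blocks \<open>A _ _ p q\<close> has norm at most \<open>sqrt D\<close> as an operator
  from \<open>\<ell>\<^sub>2(J)\<^sup>k\<close> to \<open>\<ell>\<^sub>2(I)\<^sup>k\<close>, tested on finitely supported vectors only.
\<close>

definition bmat :: "nat \<Rightarrow> 'p set \<Rightarrow> 'q set \<Rightarrow> (nat \<Rightarrow> nat \<Rightarrow> 'p \<Rightarrow> 'q \<Rightarrow> complex) \<Rightarrow> real \<Rightarrow> bool" where
  "bmat k I J A D \<longleftrightarrow> (\<forall>F E f. finite F \<and> F \<subseteq> I \<and> finite E \<and> E \<subseteq> J \<longrightarrow>
     (\<Sum>p\<in>F. \<Sum>i<k. (cmod (\<Sum>q\<in>E. \<Sum>j<k. A i j p q * f q j))\<^sup>2) \<le> D * (\<Sum>q\<in>E. \<Sum>j<k. (cmod (f q j))\<^sup>2))"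

lemma bmatI:
  assumes "\<And>F E f. \<lbrakk>finite F; F \<subseteq> I; finite E; E \<subseteq> J\<rbrakk> \<Longrightarrow>
     (\<Sum>p\<in>F. \<Sum>i<k. (cmod (\<Sum>q\<in>E. \<Sum>j<k. A i j p q * f q j))\<^sup>2) \<le> D * (\<Sum>q\<in>E. \<Sum>j<k. (cmod (f q j))\<^sup>2)"
  shows "bmat k I J A D"
  unfolding bmat_def using assms by blast

lemma bmatD:
  assumes "bmat k I J A D" "finite F" "F \<subseteq> I" "finite E" "E \<subseteq> J"
  shows "(\<Sum>p\<in>F. \<Sum>i<k. (cmod (\<Sum>q\<in>E. \<Sum>j<k. A i j p q * f q j))\<^sup>2) \<le> D * (\<Sum>q\<in>E. \<Sum>j<k. (cmod (f q j))\<^sup>2)"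
  using assms unfolding bmat_def by blast

lemma bmat_cong:
  assumes "bmat k I J A D" "\<And>p q i j. \<lbrakk>p \<in> I; q \<in> J; i < k; j < k\<rbrakk> \<Longrightarrow> A i j p q = B i j p q"
  shows "bmat k I J B D"
proof (rule bmatI)
  fix F :: "'a set" and E :: "'b set" and f :: "'b \<Rightarrow> nat \<Rightarrow> complex"
  assume *: "finite F" "F \<subseteq> I" "finite E" "E \<subseteq> J"
  have "(\<Sum>p\<in>F. \<Sum>i<k. (cmod (\<Sum>q\<in>E. \<Sum>j<k. B i j p q * f q j))\<^sup>2)
      = (\<Sum>p\<in>F. \<Sum>i<k. (cmod (\<Sum>q\<in>E. \<Sum>j<k. A i j p q * f q j))\<^sup>2)"
    by (intro sum.cong refl arg_cong[where f = "\<lambda>x. (cmod x)\<^sup>2"]) (use assms(2) * in \<open>auto simp: subset_iff\<close>)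
  then show "(\<Sum>p\<in>F. \<Sum>i<k. (cmod (\<Sum>q\<in>E. \<Sum>j<k. B i j p q * f q j))\<^sup>2) \<le> D * (\<Sum>q\<in>E. \<Sum>j<k. (cmod (f q j))\<^sup>2)"
    using bmatD[OF assms(1) *] by simp
qed

lemma cmod_add_square_le: "(cmod (x + y))\<^sup>2 \<le> 2 * (cmod x)\<^sup>2 + 2 * (cmod y)\<^sup>2"
proof -
  have "(cmod (x + y))\<^sup>2 \<le> (cmod x + cmod y)\<^sup>2"
    by (simp add: norm_triangle_ineq power_mono)
  also have "\<dots> \<le> 2 * (cmod x)\<^sup>2 + 2 * (cmod y)\<^sup>2"
    using sum_squares_bound[of "cmod x" "cmod y"] by (simp add: power2_sum)
  finally show ?thesis .
qed

lemma bmat_add: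
  assumes "bmat k I J A D" "bmat k I J B D'"
  shows "bmat k I J (\<lambda>i j p q. A i j p q + B i j p q) (2 * D + 2 * D')"
proof (rule bmatI)
  fix F :: "'a set" and E :: "'b set" and f :: "'b \<Rightarrow> nat \<Rightarrow> complex"
  assume *: "finite F" "F \<subseteq> I" "finite E" "E \<subseteq> J"
  have "(\<Sum>p\<in>F. \<Sum>i<k. (cmod (\<Sum>q\<in>E. \<Sum>j<k. (A i j p q + B i j p q) * f q j))\<^sup>2)
      \<le> (\<Sum>p\<in>F. \<Sum>i<k. 2 * (cmod (\<Sum>q\<in>E. \<Sum>j<k. A i j p q * f q j))\<^sup>2
            + 2 * (cmod (\<Sum>q\<in>E. \<Sum>j<k. B i j p q * f q j))\<^sup>2)"
    by (intro sum_mono) (simp only: distrib_right sum.distrib cmod_add_square_le)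
  also have "\<dots> = 2 * (\<Sum>p\<in>F. \<Sum>i<k. (cmod (\<Sum>q\<in>E. \<Sum>j<k. A i j p q * f q j))\<^sup>2)
            + 2 * (\<Sum>p\<in>F. \<Sum>i<k. (cmod (\<Sum>q\<in>E. \<Sum>j<k. B i j p q * f q j))\<^sup>2)"
    by (simp add: sum.distrib sum_distrib_left)
  also have "\<dots> \<le> 2 * (D * (\<Sum>q\<in>E. \<Sum>j<k. (cmod (f q j))\<^sup>2)) + 2 * (D' * (\<Sum>q\<in>E. \<Sum>j<k. (cmod (f q j))\<^sup>2))"
    by (intro add_mono mult_left_mono bmatD[OF assms(1) *] bmatD[OF assms(2) *]) auto
  finally show "(\<Sum>p\<in>F. \<Sum>i<k. (cmod (\<Sum>q\<in>E. \<Sum>j<k. (A i j p q + B i j p q) * f q j))\<^sup>2)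
      \<le> (2 * D + 2 * D') * (\<Sum>q\<in>E. \<Sum>j<k. (cmod (f q j))\<^sup>2)"
    by (simp add: algebra_simps)
qed

lemma bmat_cmult:
  assumes "bmat k I J A D"
  shows "bmat k I J (\<lambda>i j p q. c * A i j p q) ((cmod c)\<^sup>2 * D)"
proof (rule bmatI)
  fix F :: "'a set" and E :: "'b set" and f :: "'b \<Rightarrow> nat \<Rightarrow> complex"
  assume *: "finite F" "F \<subseteq> I" "finite E" "E \<subseteq> J"
  show "(\<Sum>p\<in>F. \<Sum>i<k. (cmod (\<Sum>q\<in>E. \<Sum>j<k. c * A i j p q * f q j))\<^sup>2)
      \<le> (cmod c)\<^sup>2 * D * (\<Sum>q\<in>E. \<Sum>j<k. (cmod (f q j))\<^sup>2)"
    using mult_left_mono[OF bmatD[OF assms *], of "(cmod c)\<^sup>2" f]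
    by (simp add: sum_distrib_left[symmetric] mult.assoc norm_mult power_mult_distrib)
qed

lemma bmat_mono:
  assumes "bmat k I J A D" "D \<le> D'"
  shows "bmat k I J A D'"
proof (rule bmatI)
  fix F :: "'a set" and E :: "'b set" and f :: "'b \<Rightarrow> nat \<Rightarrow> complex"
  assume *: "finite F" "F \<subseteq> I" "finite E" "E \<subseteq> J"
  have "D * (\<Sum>q\<in>E. \<Sum>j<k. (cmod (f q j))\<^sup>2) \<le> D' * (\<Sum>q\<in>E. \<Sum>j<k. (cmod (f q j))\<^sup>2)"
    by (intro mult_right_mono assms sum_nonneg) auto
  then show "(\<Sum>p\<in>F. \<Sum>i<k. (cmod (\<Sum>q\<in>E. \<Sum>j<k. A i j p q * f q j))\<^sup>2) \<le> D' * (\<Sum>q\<in>E. \<Sum>j<k. (cmod (f q j))\<^sup>2)"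
    using bmatD[OF assms(1) *, of f] by linarith
qed

text \<open>Passing to a submatrix, up to renaming, does not increase the norm. Injectivity of
  \<open>\<beta>\<close> lets a test vector be transported without merging coordinates.\<close>

lemma bmat_reindex:
  assumes "bmat k I J A D" "inj_on \<alpha> I'" "\<alpha> ` I' \<subseteq> I" "inj_on \<beta> J'" "\<beta> ` J' \<subseteq> J"
    and "\<And>p q i j. \<lbrakk>p \<in> I'; q \<in> J'; i < k; j < k\<rbrakk> \<Longrightarrow> B i j p q = A i j (\<alpha> p) (\<beta> q)"
  shows "bmat k I' J' B D"
proof (rule bmatI)
  fix F :: "'c set" and E :: "'d set" and f :: "'d \<Rightarrow> nat \<Rightarrow> complex"
  assume *: "finite F" "F \<subseteq> I'" "finite E" "E \<subseteq> J'"
  have iF: "inj_on \<alpha> F" and iE: "inj_on \<beta> E"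
    using assms * by (meson inj_on_subset)+
  have g: "inv_into J' \<beta> (\<beta> q) = q" if "q \<in> E" for q
    using assms(4) * that by (meson inv_into_f_f subsetD)
  have B: "B i j p q = A i j (\<alpha> p) (\<beta> q)" if "p \<in> F" "q \<in> E" "i < k" "j < k" for i j p q
    using assms(6) that * by blast
  have "\<alpha> ` F \<subseteq> I" "\<beta> ` E \<subseteq> J" using * assms(3,5) by blast+
  then show "(\<Sum>p\<in>F. \<Sum>i<k. (cmod (\<Sum>q\<in>E. \<Sum>j<k. B i j p q * f q j))\<^sup>2) \<le> D * (\<Sum>q\<in>E. \<Sum>j<k. (cmod (f q j))\<^sup>2)"
    using bmatD[OF assms(1), of "\<alpha> ` F" "\<beta> ` E" "\<lambda>q. f (inv_into J' \<beta> q)"] *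
    by (simp add: sum.reindex[OF iF] sum.reindex[OF iE] g B subset_iff cong: sum.cong_simp)
qed

text \<open>For a block diagonal matrix the norm is the supremum over the blocks: the labels
  \<open>r\<close> and \<open>s\<close> partition rows and columns, and each block sees its own
  share of the vector. Hence infinitely many blocks cost no constant.\<close>

lemma bmat_block:
  fixes I :: "'p set" and J :: "'q set" and r :: "'p \<Rightarrow> 'r"
  assumes "\<And>\<rho>. bmat k {p\<in>I. r p = \<rho>} {q\<in>J. s q = \<rho>} A D"
    and "\<And>p q i j. \<lbrakk>p \<in> I; q \<in> J; i < k; j < k; r p \<noteq> s q\<rbrakk> \<Longrightarrow> A i j p q = 0"
  shows "bmat k I J A D"
proof (rule bmatI)
  fix F :: "'p set" and E :: "'q set" and f :: "'q \<Rightarrow> nat \<Rightarrow> complex"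
  assume *: "finite F" "F \<subseteq> I" "finite E" "E \<subseteq> J"
  let ?T = "r ` F \<union> s ` E"
  let ?N = "\<lambda>p E. \<Sum>i<k. (cmod (\<Sum>q\<in>E. \<Sum>j<k. A i j p q * f q j))\<^sup>2"
  have N: "(\<Sum>q\<in>E. \<Sum>j<k. A i j p q * f q j) = (\<Sum>q | q \<in> E \<and> s q = r p. \<Sum>j<k. A i j p q * f q j)"
    if "p \<in> F" "i < k" for p i
    using * that by (intro sum.mono_neutral_right) (auto intro!: sum.neutral assms(2) simp: subset_iff)
  have "(\<Sum>p\<in>F. ?N p E) = (\<Sum>\<rho>\<in>?T. \<Sum>p | p \<in> F \<and> r p = \<rho>. ?N p E)"
    using * by (intro sum.group[symmetric]) auto
  also have "\<dots> = (\<Sum>\<rho>\<in>?T. \<Sum>p | p \<in> F \<and> r p = \<rho>. ?N p {q\<in>E. s q = \<rho>})"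
    by (intro sum.cong refl) (use N in auto)
  also have "\<dots> \<le> (\<Sum>\<rho>\<in>?T. D * (\<Sum>q | q \<in> E \<and> s q = \<rho>. \<Sum>j<k. (cmod (f q j))\<^sup>2))"
    using * by (intro sum_mono bmatD[OF assms(1)]) auto
  also have "\<dots> = D * (\<Sum>\<rho>\<in>?T. \<Sum>q | q \<in> E \<and> s q = \<rho>. \<Sum>j<k. (cmod (f q j))\<^sup>2)"
    by (simp add: sum_distrib_left)
  also have "(\<Sum>\<rho>\<in>?T. \<Sum>q | q \<in> E \<and> s q = \<rho>. \<Sum>j<k. (cmod (f q j))\<^sup>2) = (\<Sum>q\<in>E. \<Sum>j<k. (cmod (f q j))\<^sup>2)"
    using * by (intro sum.group) auto
  finally show "(\<Sum>p\<in>F. ?N p E) \<le> D * (\<Sum>q\<in>E. \<Sum>j<k. (cmod (f q j))\<^sup>2)" .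
qed

lemma bmat_extend_rows:
  assumes "bmat k I' J A D" "\<And>p q i j. \<lbrakk>p \<in> I - I'; q \<in> J; i < k; j < k\<rbrakk> \<Longrightarrow> A i j p q = 0"
  shows "bmat k I J A D"
proof (rule bmatI)
  fix F :: "'a set" and E :: "'b set" and f :: "'b \<Rightarrow> nat \<Rightarrow> complex"
  assume *: "finite F" "F \<subseteq> I" "finite E" "E \<subseteq> J"
  have "(\<Sum>p\<in>F. \<Sum>i<k. (cmod (\<Sum>q\<in>E. \<Sum>j<k. A i j p q * f q j))\<^sup>2)
      = (\<Sum>p\<in>F \<inter> I'. \<Sum>i<k. (cmod (\<Sum>q\<in>E. \<Sum>j<k. A i j p q * f q j))\<^sup>2)"
    using * by (intro sum.mono_neutral_right) (auto intro!: sum.neutral assms(2) simp: subset_iff)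
  then show "(\<Sum>p\<in>F. \<Sum>i<k. (cmod (\<Sum>q\<in>E. \<Sum>j<k. A i j p q * f q j))\<^sup>2) \<le> D * (\<Sum>q\<in>E. \<Sum>j<k. (cmod (f q j))\<^sup>2)"
    using bmatD[OF assms(1), of "F \<inter> I'" E f] * by simp
qed

lemma bmat_extend_cols:
  assumes "bmat k I J' A D" "0 \<le> D" "J' \<subseteq> J" "\<And>p q i j. \<lbrakk>p \<in> I; q \<in> J - J'; i < k; j < k\<rbrakk> \<Longrightarrow> A i j p q = 0"
  shows "bmat k I J A D"
proof (rule bmatI)
  fix F :: "'a set" and E :: "'b set" and f :: "'b \<Rightarrow> nat \<Rightarrow> complex"
  assume *: "finite F" "F \<subseteq> I" "finite E" "E \<subseteq> J"
  have "(\<Sum>p\<in>F. \<Sum>i<k. (cmod (\<Sum>q\<in>E. \<Sum>j<k. A i j p q * f q j))\<^sup>2)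
      = (\<Sum>p\<in>F. \<Sum>i<k. (cmod (\<Sum>q\<in>E \<inter> J'. \<Sum>j<k. A i j p q * f q j))\<^sup>2)"
    using * by (intro sum.cong refl arg_cong[where f = "\<lambda>x. (cmod x)\<^sup>2"] sum.mono_neutral_right)
      (auto intro!: sum.neutral assms(4) simp: subset_iff)
  also have "\<dots> \<le> D * (\<Sum>q\<in>E \<inter> J'. \<Sum>j<k. (cmod (f q j))\<^sup>2)"
    using * by (intro bmatD[OF assms(1)]) auto
  \<comment> \<open>Restoring the mass of \<open>f\<close> on the zero columns enlarges the right
    side because \<open>0 \<le> D\<close>.\<close>
  also have "\<dots> \<le> D * (\<Sum>q\<in>E. \<Sum>j<k. (cmod (f q j))\<^sup>2)"
    using * assms(2) by (intro mult_left_mono sum_mono2) (auto intro: sum_nonneg)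
  finally show "(\<Sum>p\<in>F. \<Sum>i<k. (cmod (\<Sum>q\<in>E. \<Sum>j<k. A i j p q * f q j))\<^sup>2) \<le> D * (\<Sum>q\<in>E. \<Sum>j<k. (cmod (f q j))\<^sup>2)" .
qed

section \<open>Free groups as reduced words\<close>

notation wmult (infixl "\<odot>" 70)

lemma reduced_Cons:
  "reduced (x # ys) \<longleftrightarrow> reduced ys \<and> (ys \<noteq> [] \<longrightarrow> \<not> (fst x = fst (hd ys) \<and> snd x \<noteq> snd (hd ys)))"
  by (cases ys) auto

lemma reduced_cons_red: "reduced ys \<Longrightarrow> reduced (cons_red x ys)"
  by (cases ys) (auto simp: reduced_Cons)

lemma wmult_Nil [simp]: "[] \<odot> ys = ys"
  and wmult_Cons: "(x # xs) \<odot> ys = cons_red x (xs \<odot> ys)"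
  and wmult_append: "(xs @ xs') \<odot> ys = xs \<odot> (xs' \<odot> ys)"
  by (simp_all add: wmult_def)

lemma reduced_wmult: "reduced ys \<Longrightarrow> reduced (xs \<odot> ys)"
  by (induction xs) (simp_all add: wmult_Cons reduced_cons_red)

lemma cons_red_reduced: "reduced (x # xs) \<Longrightarrow> cons_red x xs = x # xs"
  by (cases xs) auto

lemma wmult_Nil_right: "reduced xs \<Longrightarrow> xs \<odot> [] = xs"
  by (induction xs) (auto simp: wmult_Cons cons_red_reduced reduced_Cons)

text \<open>If \<open>y\<close> cancels the first letter of \<open>zs\<close>, that letter is
  \<open>x\<close>; as \<open>zs\<close> is reduced, putting \<open>x\<close> back triggers no
  further cancellation.\<close>

lemma cons_red_cancel:
  "reduced zs \<Longrightarrow> fst x = fst y \<Longrightarrow> snd x \<noteq> snd y \<Longrightarrow> cons_red x (cons_red y zs) = zs"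
  by (cases x; cases y; cases zs rule: reduced.cases) auto

lemma cons_red_wmult:
  "reduced zs \<Longrightarrow> cons_red x ys \<odot> zs = cons_red x (ys \<odot> zs)"
  by (cases ys) (auto simp: wmult_Cons cons_red_cancel reduced_wmult)

text \<open>A word acts on reduced words by composing the actions of its letters, and inverse
  neighbours act trivially. Reducedness is therefore asked of the last factor, the one acted
  upon.\<close>

lemma wmult_assoc: "reduced zs \<Longrightarrow> xs \<odot> ys \<odot> zs = xs \<odot> (ys \<odot> zs)"
  by (induction xs) (simp_all add: wmult_Cons cons_red_wmult)

lemma winv_Nil: "winv [] = []"
  by (simp add: winv_def)

lemma winv_Cons: "winv (x # xs) = winv xs @ [(fst x, \<not> snd x)]"
  by (simp add: winv_def split_beta)

lemma winv_winv [simp]: "winv (winv xs) = xs"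
  by (simp add: winv_def rev_map split_beta comp_def)

lemma winv_wmult_cancel: "reduced ys \<Longrightarrow> winv xs \<odot> (xs \<odot> ys) = ys"
  by (induction xs) (auto simp: winv_Cons wmult_Cons wmult_append winv_def cons_red_cancel reduced_wmult)

lemma wmult_winv_cancel: "reduced ys \<Longrightarrow> xs \<odot> (winv xs \<odot> ys) = ys"
  using winv_wmult_cancel[of ys "winv xs"] by simp

lemma free_grp_reduced: "x \<in> free_grp S \<Longrightarrow> reduced x"
  by (simp add: free_grp_def)

lemma Nil_in_free_grp [simp]: "[] \<in> free_grp S"
  by (simp add: free_grp_def)

lemma set_cons_red: "set (cons_red x ys) \<subseteq> insert x (set ys)"
  by (cases ys) auto

lemma set_wmult: "set (xs \<odot> ys) \<subseteq> set xs \<union> set ys"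
  using set_cons_red by (induction xs) (fastforce simp: wmult_Cons)+

lemma reduced_winv: "reduced xs \<Longrightarrow> reduced (winv xs)"
proof (induction xs)
  case (Cons x xs)
  have *: "reduced (ys @ [y]) \<longleftrightarrow> reduced ys \<and> (ys \<noteq> [] \<longrightarrow> \<not> (fst (last ys) = fst y \<and> snd (last ys) \<noteq> snd y))"
    for y and ys :: word
    by (induction ys) (auto simp: reduced_Cons hd_append)
  show ?case
    using Cons by (auto simp: winv_Cons * reduced_Cons) (auto simp: winv_def last_rev hd_map split_beta)
qed (simp add: winv_def)

lemma wmult_in_free_grp: "x \<in> free_grp S \<Longrightarrow> y \<in> free_grp S \<Longrightarrow> x \<odot> y \<in> free_grp S"
  using set_wmult[of x y] by (auto simp: free_grp_def reduced_wmult)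

lemma winv_in_free_grp: "x \<in> free_grp S \<Longrightarrow> winv x \<in> free_grp S"
  by (auto simp: free_grp_def reduced_winv) (auto simp: winv_def)

lemmas free_grp_closed = wmult_in_free_grp winv_in_free_grp

lemma winv_left: "winv x \<odot> x = []" if "reduced x"
  using winv_wmult_cancel[of "[]" x] that by (simp add: wmult_Nil_right)

lemma winv_right: "x \<odot> winv x = []" if "reduced x"
  using winv_left[of "winv x"] that by (simp add: reduced_winv)

lemma winv_wmult:
  assumes "reduced x" "reduced y"
  shows "winv (x \<odot> y) = winv y \<odot> winv x"
proof -
  have "winv (x \<odot> y) \<odot> ((x \<odot> y) \<odot> (winv y \<odot> winv x)) = winv y \<odot> winv x"
    using assms by (intro winv_wmult_cancel reduced_wmult reduced_winv)
  moreover have "(x \<odot> y) \<odot> (winv y \<odot> winv x) = []"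
    using assms by (simp add: wmult_assoc reduced_wmult reduced_winv wmult_winv_cancel winv_right)
  ultimately show ?thesis
    using assms by (simp add: wmult_Nil_right reduced_winv reduced_wmult)
qed

lemma wmult_right_cancel:
  assumes "reduced x" "reduced y" "reduced z" "x \<odot> z = y \<odot> z"
  shows "x = y"
proof -
  have "x \<odot> z \<odot> winv z = y \<odot> z \<odot> winv z" using assms by simp
  then show ?thesis using assms(1-3) by (simp add: wmult_assoc reduced_winv winv_right wmult_Nil_right)
qed

lemma wmult_left_cancel:
  assumes "reduced x" "reduced y" "z \<odot> x = z \<odot> y"
  shows "x = y"
  by (metis assms winv_wmult_cancel)

lemma wmult_winv_eq:
  assumes "reduced x" "reduced y" "reduced z" "z \<odot> winv y = x"
  shows "z = x \<odot> y"
  using assms by (metis wmult_assoc winv_left wmult_Nil_right)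

section \<open>A ping-pong embedding\<close>

text \<open>
  With \<open>a = (0, True)\<close> and \<open>b = (1, True)\<close>, the words \<open>b\<^sup>j a b\<^sup>-\<^sup>j\<close> are free generators. The odd \<open>j\<close>
  are the images under \<open>emb\<close> of the generators of the embedded group, and the even ones are the
  elements \<open>h\<^sub>m\<close>; \<open>point m x\<close> is the element \<open>h\<^sub>m x\<close> of the coset of \<open>h\<^sub>m\<close>.
\<close>

definition conj_word :: "nat \<Rightarrow> bool \<Rightarrow> word" where
  "conj_word j e = replicate j (1, True) @ (0, e) # replicate j (1, False)"

text \<open>The ping-pong sets: \<open>conj_word j e\<close> moves every reduced word outside
  \<open>starts j (\<not> e)\<close> into \<open>starts j e\<close>.\<close>

definition starts :: "nat \<Rightarrow> bool \<Rightarrow> word \<Rightarrow> bool" where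
  "starts j e u \<longleftrightarrow> (\<exists>t. u = replicate j (1, True) @ (0, e) # t)"

text \<open>Nothing is cancelled here, so the action on a reduced word can be followed letter by
  letter; \<open>emb\<close> is the reduced form.\<close>

definition emb_word :: "word \<Rightarrow> word" where
  "emb_word w = concat (map (\<lambda>(j, e). conj_word (2 * j + 1) e) w)"

definition emb :: "word \<Rightarrow> word" where
  "emb w = emb_word w \<odot> []"

definition point :: "nat \<Rightarrow> word \<Rightarrow> word" where
  "point m x = conj_word (2 * m) True \<odot> emb x"

text \<open>The number of leading letters b recovers \<open>j\<close>, and the letter following them
  recovers \<open>e\<close>.\<close>

lemma starts_unique: "starts j e u \<Longrightarrow> starts j' e' u \<Longrightarrow> j = j' \<and> e = e'"
proof -
  have "length (takeWhile (\<lambda>l. l = (1, True)) u) = j \<and> u ! j = (0, e)" if "starts j e u" for j e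
    using that by (auto simp: starts_def takeWhile_append nth_append)
  then show "starts j e u \<Longrightarrow> starts j' e' u \<Longrightarrow> j = j' \<and> e = e'"
    by (metis prod.inject)
qed

lemma replicate_wmult:
  assumes "v \<noteq> []" "fst (hd v) = 0"
  shows "replicate j (1, True) \<odot> v = replicate j (1, True) @ v"
proof (induction j)
  case (Suc j)
  then show ?case using assms
    by (cases j; cases v) (auto simp: wmult_Cons)
qed simp

lemma winv_replicate: "winv (replicate j (1, True)) = replicate j (1, False)"
  by (simp add: winv_def)

text \<open>Write \<open>u\<close> as b^j times the reduced word \<open>v\<close>. If the middle
  letter cancelled against \<open>v\<close>, then \<open>v\<close> would begin with its inverse and
  \<open>u\<close> would lie in the excluded set.\<close>

lemma conj_word_wmult_starts:
  assumes "reduced u" "\<not> starts j (\<not> e) u"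
  shows "starts j e (conj_word j e \<odot> u)"
proof -
  define v where "v = replicate j (1, False) \<odot> u"
  have u: "u = replicate j (1, True) \<odot> v"
    using wmult_winv_cancel[OF assms(1), of "replicate j (1, True)"] unfolding v_def winv_replicate by simp
  have "cons_red (0, e) v = (0, e) # v"
  proof (cases v)
    case (Cons y t)
    have "y \<noteq> (0, \<not> e)"
      using assms(2) replicate_wmult[of v j] Cons unfolding u starts_def by auto
    then show ?thesis using Cons by (cases y) auto
  qed simp
  then have "conj_word j e \<odot> u = replicate j (1, True) @ (0, e) # v"
    by (simp only: conj_word_def wmult_append wmult_Cons v_def[symmetric])
      (use replicate_wmult[of "(0, e) # v" j] in simp)
  then show ?thesis by (auto simp: starts_def)
qed

lemma winv_conj_word: "winv (conj_word j e) = conj_word j (\<not> e)"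
  by (simp add: winv_def conj_word_def)

lemma emb_word_Cons: "emb_word (l # w) = conj_word (2 * fst l + 1) (snd l) @ emb_word w"
  by (simp add: emb_word_def split_beta)

text \<open>
  Each letter of a reduced word moves the current point into the set of words with the odd prefix
  belonging to that letter; no step can cancel since the next letter is not the inverse.
\<close>

lemma emb_word_starts:
  assumes "reduced (l # w)" "reduced u" "starts (2 * m) e u"
  shows "starts (2 * fst l + 1) (snd l) (emb_word (l # w) \<odot> u)"
  using assms(1)
proof (induction w arbitrary: l)
  case Nil
  \<comment> \<open>The prefix of \<open>u\<close> has an even index, so it cannot be one of the odd
    prefixes.\<close>
  have "\<not> starts (2 * fst l + 1) (\<not> snd l) u"
    using starts_unique[OF assms(3)] by (metis even_Suc Suc_eq_plus1 dvd_triv_left)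
  then show ?case
    using conj_word_wmult_starts assms(2) by (simp add: emb_word_Cons wmult_append) (simp add: emb_word_def)
next
  case (Cons l' w)
  have "starts (2 * fst l' + 1) (snd l') (emb_word (l' # w) \<odot> u)"
    using Cons by auto
  then have "\<not> starts (2 * fst l + 1) (\<not> snd l) (emb_word (l' # w) \<odot> u)"
    using Cons.prems starts_unique by fastforce
  then show ?case
    unfolding emb_word_Cons[of l] wmult_append
    using conj_word_wmult_starts assms(2) reduced_wmult by blast
qed

lemma reduced_emb: "reduced (emb x)"
  by (simp add: emb_def reduced_wmult)

lemma emb_wmult: "reduced u \<Longrightarrow> emb x \<odot> u = emb_word x \<odot> u"
  by (simp add: emb_def wmult_assoc)

lemma emb_word_cons_red:
  assumes "reduced u"
  shows "emb_word (cons_red l y) \<odot> u = conj_word (2 * fst l + 1) (snd l) \<odot> (emb_word y \<odot> u)"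
proof (cases y)
  case (Cons l' y')
  show ?thesis
  proof (cases "fst l = fst l' \<and> snd l \<noteq> snd l'")
    case True
    then have "conj_word (2 * fst l' + 1) (snd l') = winv (conj_word (2 * fst l + 1) (snd l))"
      by (auto simp: winv_conj_word)
    then show ?thesis using True Cons assms
      by (simp add: emb_word_Cons wmult_append wmult_winv_cancel reduced_wmult)
  qed (auto simp: Cons emb_word_Cons wmult_append)
qed (simp add: emb_word_Cons wmult_append)

lemma emb_word_wmult: "reduced u \<Longrightarrow> emb_word (x \<odot> y) \<odot> u = emb_word x \<odot> (emb_word y \<odot> u)"
proof (induction x)
  case Nil
  then show ?case by (simp add: emb_word_def)
next
  case (Cons l x)
  then show ?case by (simp add: wmult_Cons emb_word_cons_red) (simp add: emb_word_Cons wmult_append)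
qed

lemma emb_hom: "emb (x \<odot> y) = emb x \<odot> emb y"
  by (simp add: emb_def emb_word_wmult emb_wmult reduced_wmult wmult_assoc)

lemma emb_Nil [simp]: "emb [] = []"
  by (simp add: emb_def emb_word_def)

lemma emb_winv: "reduced x \<Longrightarrow> emb (winv x) = winv (emb x)"
proof -
  assume "reduced x"
  then have "emb (winv x) \<odot> emb x = []"
    by (simp add: winv_left flip: emb_hom)
  then show ?thesis
    by (metis reduced_emb reduced_winv winv_left wmult_right_cancel)
qed

lemma reduced_conj_word: "reduced (conj_word j e)"
proof -
  have "reduced (replicate j (1, False))"
    by (induction j) (auto simp: reduced_Cons hd_replicate)
  then have *: "reduced ((0, e) # replicate j (1, False))"
    by (auto simp: reduced_Cons hd_replicate)
  have "reduced (replicate i (1, True) @ (0, e) # replicate j (1, False))" for i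
  proof (induction i)
    case (Suc i)
    then show ?case using * by (auto simp: reduced_Cons hd_append hd_replicate)
  qed (use * in simp)
  then show ?thesis by (simp add: conj_word_def)
qed

lemma conj_word_in_free_grp: "{0, 1} \<subseteq> S \<Longrightarrow> conj_word j e \<in> free_grp S"
  using reduced_conj_word by (auto simp: free_grp_def conj_word_def)

lemma emb_in_free_grp:
  assumes "{0, 1} \<subseteq> S"
  shows "emb x \<in> free_grp S"
proof (induction x)
  case (Cons l x)
  have "emb (l # x) = conj_word (2 * fst l + 1) (snd l) \<odot> emb x"
    by (simp add: emb_def emb_word_Cons wmult_append)
  then show ?case using Cons conj_word_in_free_grp[OF assms] by (simp add: wmult_in_free_grp)
qed simp

lemma point_in_free_grp: "{0, 1} \<subseteq> S \<Longrightarrow> point m x \<in> free_grp S"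
  by (simp add: point_def conj_word_in_free_grp emb_in_free_grp wmult_in_free_grp)

lemma reduced_point: "reduced (point m x)"
  by (simp add: point_def reduced_wmult reduced_emb)

text \<open>The ping-pong core. If \<open>point m x \<odot> w\<close> misses the prefix of h_m, then
  \<open>emb x \<odot> w\<close> must begin with b^(2m) followed by the inverse of a. Two such words
  differ by an element of the embedded group, which would turn an even prefix into an odd one unless
  it is trivial.\<close>

lemma point_wmult_unique:
  assumes "reduced x" "reduced x'" "reduced w"
    and "\<not> starts (2 * m) True (point m x \<odot> w)" "\<not> starts (2 * m') True (point m' x' \<odot> w)"
  shows "m = m' \<and> x = x'"
proof -
  let ?u = "emb x \<odot> w" and ?u' = "emb x' \<odot> w"
  have ru: "reduced ?u" "reduced ?u'" using assms by (simp_all add: reduced_wmult)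
  have 1: "starts (2 * m) False ?u" and 2: "starts (2 * m') False ?u'"
    using assms conj_word_wmult_starts[OF ru(1), of "2 * m" True] conj_word_wmult_starts[OF ru(2), of "2 * m'" True]
    by (auto simp: point_def wmult_assoc)
  have eq: "?u' = emb_word (x' \<odot> winv x) \<odot> ?u"
    using assms ru
    by (simp add: emb_wmult[symmetric] emb_hom emb_winv wmult_assoc winv_wmult_cancel)
  have "x' \<odot> winv x = []"
  proof (cases "x' \<odot> winv x")
    case (Cons l k)
    have "reduced (l # k)" using assms Cons reduced_wmult reduced_winv by metis
    from emb_word_starts[OF this ru(1) 1] have "starts (2 * fst l + 1) (snd l) ?u'"
      using eq Cons by simp
    from starts_unique[OF this 2] have "odd (2 * m')" by (metis even_Suc Suc_eq_plus1 dvd_triv_left)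
    then show ?thesis by simp
  qed
  then have "x' = x"
    using wmult_winv_eq[of "[]" x x'] assms by simp
  then show ?thesis using starts_unique[OF 1] 2 by fastforce
qed

lemma point_inj:
  assumes "reduced x" "reduced x'" "point m x = point m' x'"
  shows "m = m' \<and> x = x'"
\<comment> \<open>With this \<open>w\<close> both products are the empty word, which has no prefix
  of the required form.\<close>
proof (rule point_wmult_unique[OF assms(1,2), of "winv (point m x)"])
  have "\<not> starts j e []" for j e by (simp add: starts_def)
  then show "\<not> starts (2 * m) True (point m x \<odot> winv (point m x))"
    "\<not> starts (2 * m') True (point m' x' \<odot> winv (point m x))"
    using assms by (simp_all add: winv_right reduced_point)
qed (simp add: reduced_winv reduced_point)

lemma emb_inj: "reduced x \<Longrightarrow> reduced x' \<Longrightarrow> emb x = emb x' \<Longrightarrow> x = x'"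
  using point_inj[of x x' 0 0] by (simp add: point_def)

lemma point_wmult_winv:
  assumes "reduced x" "reduced y"
  shows "point m (x \<odot> winv y) = point m x \<odot> winv (emb y)"
  using assms by (simp add: point_def emb_hom emb_winv wmult_assoc reduced_winv reduced_emb)

section \<open>Operators supported on the cosets\<close>

text \<open>Since \<open>\<lambda>(v)\<close> sends the basis vector at y to the one at vy, this is
  the matrix of the block operator with coefficients \<open>a i j v\<close> at
  \<open>\<lambda>(v)\<close>; its squared norm is at most \<open>D\<close>.\<close>

definition bconv :: "nat set \<Rightarrow> nat \<Rightarrow> (nat \<Rightarrow> nat \<Rightarrow> word \<Rightarrow> complex) \<Rightarrow> real \<Rightarrow> bool" where
  "bconv S k a D \<longleftrightarrow> bmat k (free_grp S) (free_grp S) (\<lambda>i j z y. a i j (z \<odot> winv y)) D"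

definition cosets :: "nat set \<Rightarrow> word set" where
  "cosets S = {point m x | m x. x \<in> free_grp S}"

text \<open>On the cosets this inverts \<open>point\<close>, the choice being unique by
  \<open>point_inj\<close>; elsewhere the value is arbitrary.\<close>

definition coord :: "nat set \<Rightarrow> word \<Rightarrow> nat \<times> word" where
  "coord S v = (SOME p. snd p \<in> free_grp S \<and> v = point (fst p) (snd p))"

lemma coord:
  assumes "v \<in> cosets S"
  shows "snd (coord S v) \<in> free_grp S" "point (fst (coord S v)) (snd (coord S v)) = v"
proof -
  have "\<exists>p. snd p \<in> free_grp S \<and> v = point (fst p) (snd p)"
    using assms by (auto simp: cosets_def)
  from someI_ex[OF this] show "snd (coord S v) \<in> free_grp S" "point (fst (coord S v)) (snd (coord S v)) = v"
    by (simp_all add: coord_def)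
qed

lemma coord_point: "x \<in> free_grp S \<Longrightarrow> coord S (point m x) = (m, x)"
  using coord[of "point m x" S] point_inj[of _ x _ m]
  by (metis (mono_tags, lifting) cosets_def free_grp_reduced mem_Collect_eq prod.collapse)

lemma winv_inj: "winv x = winv y \<Longrightarrow> x = y"
  by (metis winv_winv)

text \<open>
  The entries \<open>(z, y)\<close> for which \<open>z\<close> does not begin with the prefix of \<open>h\<^sub>m\<close> are controlled by the row
  norm, since each column contains at most one of them.
\<close>

lemma bmat_far:
  assumes T: "{0, 1} \<subseteq> T" and D: "0 \<le> D"
    and row: "bmat k {()} (UNIV \<times> free_grp S) (\<lambda>i j _ p. b i j (point (fst p) (snd p))) D"
  shows "bmat k (free_grp T) (free_grp T)
    (\<lambda>i j z y. if \<exists>m x. x \<in> free_grp S \<and> z \<odot> winv y = point m x \<and> \<not> starts (2 * m) True z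
      then b i j (z \<odot> winv y) else 0) D"
proof -
  define far where "far z y \<longleftrightarrow> (\<exists>m x. x \<in> free_grp S \<and> z \<odot> winv y = point m x \<and> \<not> starts (2 * m) True z)" for z y
  have farD: "z \<odot> winv y \<in> cosets S" if "far z y" for z y
    using that by (auto simp: far_def cosets_def)
  \<comment> \<open>Both rows have the form \<open>point m x \<odot> y\<close>, so ping-pong
    uniqueness applies with \<open>w = y\<close>.\<close>
  have uniq: "z = z'" if yz: "y \<in> free_grp T" "z \<in> free_grp T" "z' \<in> free_grp T" "far z y" "far z' y" for y z z'
  proof -
    note r = free_grp_reduced
    obtain m x where 1: "x \<in> free_grp S" "z \<odot> winv y = point m x" "\<not> starts (2 * m) True z"
      using yz by (auto simp: far_def)
    obtain m' x' where 2: "x' \<in> free_grp S" "z' \<odot> winv y = point m' x'" "\<not> starts (2 * m') True z'"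
      using yz by (auto simp: far_def)
    have z: "z = point m x \<odot> y" "z' = point m' x' \<odot> y"
      using 1 2 yz by (auto intro!: wmult_winv_eq reduced_point dest: r)
    show ?thesis
      using point_wmult_unique[of x x' y m m'] 1 2 yz z r by metis
  qed
  \<comment> \<open>\<open>s y\<close> is the row of the exceptional entry in column
    \<open>y\<close>. A column without one gets an arbitrary label, which is harmless because the
    column vanishes.\<close>
  define s where "s y = (SOME z. z \<in> free_grp T \<and> far z y)" for y
  have s: "s y = z" if "z \<in> free_grp T" "y \<in> free_grp T" "far z y" for z y
    unfolding s_def using that uniq[of y] by (intro some_equality) auto
  have "bmat k (free_grp T) (free_grp T) (\<lambda>i j z y. if far z y then b i j (z \<odot> winv y) else 0) D"
  proof (rule bmat_block[where r = "\<lambda>z. z" and s = s])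
    fix \<rho>
    show "bmat k {z \<in> free_grp T. z = \<rho>} {y \<in> free_grp T. s y = \<rho>} (\<lambda>i j z y. if far z y then b i j (z \<odot> winv y) else 0) D"
    \<comment> \<open>Each block is a single row. After removing its zero columns, distinct columns
      \<open>y\<close> give distinct elements \<open>\<rho> \<odot> winv y\<close>, so it is part of
      the row in \<open>row\<close>.\<close>
    proof (rule bmat_extend_cols[where J' = "{y \<in> free_grp T. s y = \<rho> \<and> far \<rho> y}"])
      show "bmat k {z \<in> free_grp T. z = \<rho>} {y \<in> free_grp T. s y = \<rho> \<and> far \<rho> y}
         (\<lambda>i j z y. if far z y then b i j (z \<odot> winv y) else 0) D"
      proof (rule bmat_reindex[OF row, of "\<lambda>_. ()" _ "\<lambda>y. coord S (\<rho> \<odot> winv y)"])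
        show "(\<lambda>y. coord S (\<rho> \<odot> winv y)) ` {y \<in> free_grp T. s y = \<rho> \<and> far \<rho> y} \<subseteq> UNIV \<times> free_grp S"
          by (rule image_subsetI) (simp add: mem_Times_iff coord(1)[OF farD])
        show "inj_on (\<lambda>y. coord S (\<rho> \<odot> winv y)) {y \<in> free_grp T. s y = \<rho> \<and> far \<rho> y}"
        proof (rule inj_onI, clarify)
          fix y y'
          assume *: "y \<in> free_grp T" "y' \<in> free_grp T" "far (s y) y" "far (s y) y'"
            "coord S (s y \<odot> winv y) = coord S (s y \<odot> winv y')"
          then have "s y \<odot> winv y = s y \<odot> winv y'"
            using coord(2)[OF farD] by metis
          then show "y = y'"
            using * by (meson free_grp_reduced reduced_winv winv_inj wmult_left_cancel)
        qed
      qed (auto simp: coord(2)[OF farD] inj_on_def)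
    qed (use D in auto)
  qed (use s in auto)
  then show ?thesis by (simp add: far_def)
qed

section \<open>Right cosets of the embedded subgroup\<close>

text \<open>A representative of the right coset of \<open>g\<close>. The predicate under the choice
  depends on that coset alone, which makes the representative constant on it.\<close>

definition crep :: "nat set \<Rightarrow> nat set \<Rightarrow> word \<Rightarrow> word" where
  "crep S T g = (SOME r. r \<in> free_grp T \<and> (\<exists>x\<in>free_grp S. g = emb x \<odot> r))"

lemma crep:
  assumes "g \<in> free_grp T"
  shows "crep S T g \<in> free_grp T" "\<exists>x\<in>free_grp S. g = emb x \<odot> crep S T g"
proof -
  have "\<exists>r. r \<in> free_grp T \<and> (\<exists>x\<in>free_grp S. g = emb x \<odot> r)"
    using assms by (intro exI[of _ g] conjI bexI[of _ "[]"]) auto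
  from someI_ex[OF this] show "crep S T g \<in> free_grp T" "\<exists>x\<in>free_grp S. g = emb x \<odot> crep S T g"
    by (auto simp: crep_def)
qed

lemma crep_emb:
  assumes "g \<in> free_grp T" "x \<in> free_grp S"
  shows "crep S T (emb x \<odot> g) = crep S T g"
proof -
  have "(\<exists>x'\<in>free_grp S. emb x \<odot> g = emb x' \<odot> r) \<longleftrightarrow> (\<exists>x'\<in>free_grp S. g = emb x' \<odot> r)"
    if r: "r \<in> free_grp T" for r
  proof
    assume "\<exists>x'\<in>free_grp S. emb x \<odot> g = emb x' \<odot> r"
    then obtain x' where x': "x' \<in> free_grp S" "emb x \<odot> g = emb x' \<odot> r" by auto
    have "g = winv (emb x) \<odot> (emb x \<odot> g)"
      using assms by (simp add: winv_wmult_cancel free_grp_reduced)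
    also have "\<dots> = emb (winv x \<odot> x') \<odot> r"
      using assms x' r by (simp add: emb_hom emb_winv wmult_assoc free_grp_reduced)
    finally show "\<exists>x'\<in>free_grp S. g = emb x' \<odot> r"
      using assms x' by (auto intro!: bexI[of _ "winv x \<odot> x'"] free_grp_closed)
  next
    assume "\<exists>x'\<in>free_grp S. g = emb x' \<odot> r"
    then obtain x' where x': "x' \<in> free_grp S" "g = emb x' \<odot> r" by auto
    then have "emb x \<odot> g = emb (x \<odot> x') \<odot> r"
      using r by (simp add: emb_hom wmult_assoc free_grp_reduced)
    then show "\<exists>x'\<in>free_grp S. emb x \<odot> g = emb x' \<odot> r"
      using assms x' by (auto intro!: bexI[of _ "x \<odot> x'"] free_grp_closed)
  qed
  then show ?thesis unfolding crep_def by (metis (mono_tags, lifting))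
qed

text \<open>
  The group splits into right cosets of the embedded subgroup, and on each of them the matrix is a
  copy of the column matrix on the subgroup.
\<close>

lemma bmat_subgroup_cosets:
  assumes col: "bmat k (UNIV \<times> free_grp S) (free_grp S)
      (\<lambda>i j p y. b i j (point (fst p) (snd p \<odot> winv y))) D"
  shows "bmat k (UNIV \<times> free_grp T) (free_grp T)
    (\<lambda>i j p y. if \<exists>x\<in>free_grp S. snd p \<odot> winv y = emb x
      then b i j (conj_word (2 * fst p) True \<odot> (snd p \<odot> winv y)) else 0) D"
    (is "bmat k _ _ ?A D")
proof (rule bmat_block[where r = "\<lambda>p. crep S T (snd p)" and s = "crep S T"])
  fix p y and i j :: nat
  assume *: "p \<in> (UNIV :: nat set) \<times> free_grp T" "y \<in> free_grp T" "crep S T (snd p) \<noteq> crep S T y"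
  have "snd p \<odot> winv y \<noteq> emb x" if "x \<in> free_grp S" for x
  proof
    assume "snd p \<odot> winv y = emb x"
    then have "snd p = emb x \<odot> y"
      using * by (intro wmult_winv_eq) (auto simp: reduced_emb free_grp_reduced)
    then show False using crep_emb * that by metis
  qed
  then show "?A i j p y = 0" by simp
next
  fix \<rho>
  \<comment> \<open>The coordinate of \<open>g\<close> along the coset of \<open>\<rho>\<close>. In
    a quotient of two elements of the coset \<open>\<rho>\<close> cancels, leaving the embedded
    quotient of their coordinates.\<close>
  define c where "c g = (SOME x. x \<in> free_grp S \<and> g = emb x \<odot> \<rho>)" for g
  have c: "c g \<in> free_grp S" "emb (c g) \<odot> \<rho> = g" "reduced \<rho>" if "g \<in> free_grp T" "crep S T g = \<rho>" for g
  proof -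
    have "\<exists>x. x \<in> free_grp S \<and> g = emb x \<odot> \<rho>" using crep(2)[OF that(1)] that(2) by blast
    from someI_ex[OF this] show "c g \<in> free_grp S" "emb (c g) \<odot> \<rho> = g" by (simp_all add: c_def)
    show "reduced \<rho>" using crep(1)[OF that(1)] that(2) free_grp_reduced by metis
  qed
  show "bmat k {p \<in> UNIV \<times> free_grp T. crep S T (snd p) = \<rho>} {y \<in> free_grp T. crep S T y = \<rho>} ?A D"
  proof (rule bmat_reindex[OF col, of "\<lambda>p. (fst p, c (snd p))" _ c])
    fix p :: "nat \<times> word" and q and i j :: nat
    assume p: "p \<in> {p \<in> UNIV \<times> free_grp T. crep S T (snd p) = \<rho>}" and q: "q \<in> {y \<in> free_grp T. crep S T y = \<rho>}"
    let ?x = "c (snd p) \<odot> winv (c q)"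
    have rr: "c (snd p) \<in> free_grp S" "c q \<in> free_grp S" "reduced \<rho>" using c p q by auto
    have "snd p \<odot> winv q = (emb (c (snd p)) \<odot> \<rho>) \<odot> winv (emb (c q) \<odot> \<rho>)"
      using c(2)[of "snd p"] c(2)[of q] p q by (simp add: mem_Times_iff)
    also have "\<dots> = emb ?x"
      using rr by (simp add: emb_hom emb_winv winv_wmult wmult_assoc reduced_wmult reduced_winv
        reduced_emb free_grp_reduced wmult_winv_cancel)
    finally have "snd p \<odot> winv q = emb ?x" .
    moreover have "?x \<in> free_grp S" using rr by (simp add: free_grp_closed)
    ultimately show "?A i j p q = b i j (point (fst (fst p, c (snd p))) (snd (fst p, c (snd p)) \<odot> winv (c q)))"
      by (auto simp: point_def)
  next
    show "inj_on (\<lambda>p. (fst p, c (snd p))) {p \<in> (UNIV :: nat set) \<times> free_grp T. crep S T (snd p) = \<rho>}"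
    proof (rule inj_onI)
      fix p p' :: "nat \<times> word"
      assume pp: "p \<in> {p \<in> UNIV \<times> free_grp T. crep S T (snd p) = \<rho>}" "p' \<in> {p \<in> UNIV \<times> free_grp T. crep S T (snd p) = \<rho>}"
        and eq: "(fst p, c (snd p)) = (fst p', c (snd p'))"
      from pp have "emb (c (snd p)) \<odot> \<rho> = snd p" "emb (c (snd p')) \<odot> \<rho> = snd p'"
        by (simp_all add: mem_Times_iff c(2))
      with eq show "p = p'" by (metis Pair_inject prod.collapse)
    qed
    show "inj_on c {y \<in> free_grp T. crep S T y = \<rho>}"
    proof (rule inj_onI)
      fix y y'
      assume "y \<in> {y \<in> free_grp T. crep S T y = \<rho>}" "y' \<in> {y \<in> free_grp T. crep S T y = \<rho>}" "c y = c y'"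
      moreover from this(1,2) have "emb (c y) \<odot> \<rho> = y" "emb (c y') \<odot> \<rho> = y'"
        by (simp_all add: c(2))
      ultimately show "y = y'" by metis
    qed
    show "(\<lambda>p. (fst p, c (snd p))) ` {p \<in> UNIV \<times> free_grp T. crep S T (snd p) = \<rho>} \<subseteq> (UNIV :: nat set) \<times> free_grp S"
      "c ` {y \<in> free_grp T. crep S T y = \<rho>} \<subseteq> free_grp S"
      by (auto intro: c(1))
  qed
qed

text \<open>
  The remaining entries are controlled by the column norm, since the prefix of \<open>z\<close> determines \<open>m\<close>.
\<close>

lemma bmat_near:
  assumes T: "{0, 1} \<subseteq> T"
    and col: "bmat k (UNIV \<times> free_grp S) (free_grp S)
      (\<lambda>i j p y. b i j (point (fst p) (snd p \<odot> winv y))) D"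
  shows "bmat k (free_grp T) (free_grp T)
    (\<lambda>i j z y. if \<exists>m x. x \<in> free_grp S \<and> z \<odot> winv y = point m x \<and> starts (2 * m) True z
      then b i j (z \<odot> winv y) else 0) D"
    (is "bmat k _ _ ?A D")
proof (rule bmat_extend_rows[where I' = "{z \<in> free_grp T. \<exists>m. starts (2 * m) True z}"])
  define M where "M z = (SOME m. starts (2 * m) True z)" for z
  have M: "M z = m" if "starts (2 * m) True z" for z m
    unfolding M_def using that by (rule some_equality) (use that starts_unique in fastforce)
  let ?c = "\<lambda>z. conj_word (2 * M z) True"
  show "bmat k {z \<in> free_grp T. \<exists>m. starts (2 * m) True z} (free_grp T) ?A D"
  \<comment> \<open>The row \<open>z\<close> fixes m, so h_m can be stripped off:
    \<open>z \<odot> winv y\<close> lies in the coset of h_m exactly when the stripped quotient lies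
    in the embedded group.\<close>
  proof (rule bmat_reindex[OF bmat_subgroup_cosets[OF col, of T], of "\<lambda>z. (M z, winv (?c z) \<odot> z)" _ "\<lambda>y. y"])
    fix z y and i j :: nat
    assume z: "z \<in> {z \<in> free_grp T. \<exists>m. starts (2 * m) True z}" and y: "y \<in> free_grp T"
    have r: "reduced z" "reduced y" using z y by (auto dest: free_grp_reduced)
    have eq: "?c z \<odot> (winv (?c z) \<odot> z \<odot> winv y) = z \<odot> winv y"
      using r by (simp add: wmult_assoc reduced_wmult reduced_winv wmult_winv_cancel)
    have "(\<exists>m x. x \<in> free_grp S \<and> z \<odot> winv y = point m x \<and> starts (2 * m) True z)
      \<longleftrightarrow> (\<exists>x\<in>free_grp S. z \<odot> winv y = ?c z \<odot> emb x)"
      using z M by (auto simp: point_def)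
    also have "\<dots> \<longleftrightarrow> (\<exists>x\<in>free_grp S. winv (?c z) \<odot> z \<odot> winv y = emb x)"
      using eq wmult_left_cancel r
      by (metis reduced_emb reduced_winv reduced_wmult)
    finally show "?A i j z y =
      (if \<exists>x\<in>free_grp S. snd (M z, winv (?c z) \<odot> z) \<odot> winv y = emb x
       then b i j (conj_word (2 * fst (M z, winv (?c z) \<odot> z)) True \<odot> (snd (M z, winv (?c z) \<odot> z) \<odot> winv y)) else 0)"
      by (simp add: eq)
  qed (use conj_word_in_free_grp[OF T] in \<open>auto intro!: inj_onI free_grp_closed dest!: wmult_left_cancel[rotated 2] dest: free_grp_reduced\<close>)
qed auto

text \<open>As m and x are determined by \<open>z \<odot> winv y\<close>, each entry is regular or
  exceptional but not both; the sum of the two matrices costs 2D + 2D.\<close>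

lemma bconv_cosets:
  assumes T: "{0, 1} \<subseteq> T" and D: "0 \<le> D"
    and supp: "\<And>i j v. v \<in> free_grp T \<Longrightarrow> v \<notin> cosets S \<Longrightarrow> b i j v = 0"
    and col: "bmat k (UNIV \<times> free_grp S) (free_grp S)
      (\<lambda>i j p y. b i j (point (fst p) (snd p \<odot> winv y))) D"
    and row: "bmat k {()} (UNIV \<times> free_grp S) (\<lambda>i j _ p. b i j (point (fst p) (snd p))) D"
  shows "bconv T k b (4 * D)"
  unfolding bconv_def
proof (rule bmat_cong[OF bmat_mono[OF bmat_add[OF bmat_near[OF T col] bmat_far[OF T D row]]]])
  fix z y and i j :: nat
  assume zy: "z \<in> free_grp T" "y \<in> free_grp T"
  let ?v = "z \<odot> winv y"
  have "\<not> (\<exists>m x. x \<in> free_grp S \<and> ?v = point m x \<and> starts (2 * m) True z)" if "\<not> starts (2 * m) True z"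
    "x \<in> free_grp S" "?v = point m x" for m x
    using that point_inj free_grp_reduced by metis
  moreover have "b i j ?v = 0" if "\<nexists>m x. x \<in> free_grp S \<and> ?v = point m x"
    using that by (intro supp) (auto simp: cosets_def zy free_grp_closed)
  ultimately show "(if \<exists>m x. x \<in> free_grp S \<and> ?v = point m x \<and> starts (2 * m) True z then b i j ?v else 0)
    + (if \<exists>m x. x \<in> free_grp S \<and> ?v = point m x \<and> \<not> starts (2 * m) True z then b i j ?v else 0) = b i j ?v"
    by (smt (verit) add.right_neutral add.left_neutral)
qed simp

section \<open>Column and row submatrices, and restriction to the cosets\<close>

text \<open>This is the submatrix with rows \<open>point m x\<close> and columns
  \<open>emb y\<close>, because the quotient of these two is
  \<open>point m (x \<odot> winv y)\<close>.\<close>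

lemma bconv_col:
  assumes "{0, 1} \<subseteq> T" "bconv T k a D"
  shows "bmat k (UNIV \<times> free_grp S) (free_grp S) (\<lambda>i j p y. a i j (point (fst p) (snd p \<odot> winv y))) D"
proof (rule bmat_reindex[OF assms(2)[unfolded bconv_def], of "\<lambda>p. point (fst p) (snd p)" _ emb])
  show "inj_on (\<lambda>p. point (fst p) (snd p)) (UNIV \<times> free_grp S)"
    by (rule inj_onI) (metis point_inj free_grp_reduced mem_Times_iff prod_eqI)
  show "inj_on emb (free_grp S)"
    by (rule inj_onI) (metis emb_inj free_grp_reduced)
qed (use assms(1) in \<open>auto simp: point_in_free_grp emb_in_free_grp point_wmult_winv free_grp_reduced\<close>)

text \<open>Row \<open>[]\<close> of the matrix lists all coefficients once, at the inverses of the
  columns.\<close>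

lemma bconv_row_all:
  assumes "bconv T k a D"
  shows "bmat k {()} (free_grp T) (\<lambda>i j _ v. a i j v) D"
  by (rule bmat_reindex[OF assms(1)[unfolded bconv_def], of "\<lambda>_. []" _ winv])
    (auto simp: winv_in_free_grp intro!: inj_onI winv_inj)

lemma bconv_row:
  assumes "{0, 1} \<subseteq> T" "bconv T k a D"
  shows "bmat k {()} (UNIV \<times> free_grp S) (\<lambda>i j _ p. a i j (point (fst p) (snd p))) D"
proof (rule bmat_reindex[OF bconv_row_all[OF assms(2)], of "\<lambda>_. ()" _ "\<lambda>p. point (fst p) (snd p)"])
  show "inj_on (\<lambda>p. point (fst p) (snd p)) (UNIV \<times> free_grp S)"
    by (rule inj_onI) (metis point_inj free_grp_reduced mem_Times_iff prod_eqI)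
qed (use assms(1) in \<open>auto simp: point_in_free_grp\<close>)

lemma point_in_cosets: "x \<in> free_grp S \<Longrightarrow> point m x \<in> cosets S"
  by (auto simp: cosets_def)

lemma point_wmult_in_cosets: "x \<in> free_grp S \<Longrightarrow> y \<in> free_grp S \<Longrightarrow> point m (x \<odot> winv y) \<in> cosets S"
  by (simp add: point_in_cosets free_grp_closed)

text \<open>Column and row norms of the coset part are already bounded by \<open>D\<close>, so that
  part has bound 4D. Subtracting it gives 2D + 2 * 4D.\<close>

lemma bconv_off_cosets:
  assumes T: "{0, 1} \<subseteq> T" and D: "0 \<le> D" and a: "bconv T k a D"
  shows "bconv T k (\<lambda>i j v. if v \<in> cosets S then 0 else a i j v) (10 * D)"
proof -
  let ?b = "\<lambda>i j v. if v \<in> cosets S then a i j v else 0"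
  have "bconv T k ?b (4 * D)"
  proof (rule bconv_cosets[OF T D, where S = S])
    show "bmat k (UNIV \<times> free_grp S) (free_grp S) (\<lambda>i j p y. ?b i j (point (fst p) (snd p \<odot> winv y))) D"
      by (rule bmat_cong[OF bconv_col[OF T a]]) (auto simp: point_wmult_in_cosets)
    show "bmat k {()} (UNIV \<times> free_grp S) (\<lambda>i j _ p. ?b i j (point (fst p) (snd p))) D"
      by (rule bmat_cong[OF bconv_row[OF T a]]) (auto simp: point_in_cosets)
  qed auto
  from bmat_add[OF a[unfolded bconv_def] bmat_cmult[OF this[unfolded bconv_def], of "-1"]]
  show ?thesis unfolding bconv_def by (rule bmat_mono[OF bmat_cong]) auto
qed

lemma bconv_split:
  assumes "bconv T k (\<lambda>i j v. if v \<in> cosets S then 0 else b i j v) D"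
    and "bconv T k (\<lambda>i j v. if v \<in> cosets S then b i j v else 0) D'"
  shows "bconv T k b (2 * D + 2 * D')"
  using bmat_add[OF assms[unfolded bconv_def]] unfolding bconv_def by (rule bmat_cong) auto

section \<open>The bijection between the groups\<close>

definition shift :: "nat set \<Rightarrow> word \<Rightarrow> word" where
  "shift S v = (if v \<in> cosets S then point (Suc (fst (coord S v))) (snd (coord S v)) else v)"

lemma shift_point: "x \<in> free_grp S \<Longrightarrow> shift S (point m x) = point (Suc m) x"
  by (simp add: shift_def point_in_cosets coord_point)

text \<open>Replacing m by m + 1 selects submatrices of the column and the row, so the coset part
  keeps bound 4D; off the cosets nothing moves. Together this is 2 * 10D + 2 * 4D.\<close>

lemma bconv_shift:
  assumes T: "{0, 1} \<subseteq> T" and D: "0 \<le> D" and a: "bconv T k a D"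
  shows "bconv T k (\<lambda>i j v. a i j (shift S v)) (28 * D)"
proof -
  have "bconv T k (\<lambda>i j v. if v \<in> cosets S then a i j (shift S v) else 0) (4 * D)"
  proof (rule bconv_cosets[OF T D, where S = S])
    show "bmat k (UNIV \<times> free_grp S) (free_grp S) (\<lambda>i j p y. if point (fst p) (snd p \<odot> winv y) \<in> cosets S
        then a i j (shift S (point (fst p) (snd p \<odot> winv y))) else 0) D"
      by (rule bmat_reindex[OF bconv_col[OF T a], of "\<lambda>p. (Suc (fst p), snd p)" _ _ "\<lambda>y. y"])
        (auto simp: point_wmult_in_cosets shift_point free_grp_closed intro!: inj_onI)
    show "bmat k {()} (UNIV \<times> free_grp S) (\<lambda>i j _ p. if point (fst p) (snd p) \<in> cosets S
        then a i j (shift S (point (fst p) (snd p))) else 0) D"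
      by (rule bmat_reindex[OF bconv_row[OF T a], of "\<lambda>_. ()" _ "\<lambda>p. (Suc (fst p), snd p)"])
        (auto simp: point_in_cosets shift_point intro!: inj_onI)
  qed auto
  moreover have "bconv T k (\<lambda>i j v. if v \<in> cosets S then 0 else a i j (shift S v)) (10 * D)"
    using bconv_off_cosets[OF T D a, of S] by (simp add: shift_def cong: if_cong)
  ultimately show ?thesis using bconv_split by fastforce
qed

lemma bconv_point:
  assumes T: "{0, 1} \<subseteq> T" and a: "bconv T k a D"
  shows "bconv S k (\<lambda>i j x. a i j (point m x)) D"
  unfolding bconv_def
  by (rule bmat_reindex[OF bconv_col[OF T a, of S], of "\<lambda>x. (m, x)" _ "\<lambda>y. y"]) (auto intro!: inj_onI)

text \<open>Here \<open>a'\<close> occupies the vacated coset of h_0 while the other cosets carry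
  \<open>a\<close> moved up by one. Adding the new block gives bound 4D for column and row, hence
  16D on the cosets and 2 * 10D + 2 * 16D in all.\<close>

lemma bconv_unshift:
  assumes T: "{0, 1} \<subseteq> T" and D: "0 \<le> D" and a: "bconv T k a D" and a': "bconv S k a' D"
    and b_off: "\<And>i j v. v \<in> free_grp T \<Longrightarrow> v \<notin> cosets S \<Longrightarrow> b i j v = a i j v"
    and b_0: "\<And>i j x. x \<in> free_grp S \<Longrightarrow> b i j (point 0 x) = a' i j x"
    and b_Suc: "\<And>i j m x. x \<in> free_grp S \<Longrightarrow> b i j (point (Suc m) x) = a i j (point m x)"
  shows "bconv T k b (52 * D)"
proof -
  let ?b = "\<lambda>i j v. if v \<in> cosets S then b i j v else 0"
  have D4: "0 \<le> 4 * D" using D by simp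
  have "bconv T k ?b (4 * (4 * D))"
  proof (rule bconv_cosets[OF T D4, where S = S])
    have 1: "bmat k (UNIV \<times> free_grp S) (free_grp S) (\<lambda>i j p y. if fst p = 0 then a' i j (snd p \<odot> winv y) else 0) D"
    proof (rule bmat_extend_rows[where I' = "{0} \<times> free_grp S"])
      show "bmat k ({0} \<times> free_grp S) (free_grp S) (\<lambda>i j p y. if fst p = 0 then a' i j (snd p \<odot> winv y) else 0) D"
        by (rule bmat_reindex[OF a'[unfolded bconv_def], of snd _ "\<lambda>y. y"]) (auto intro!: inj_onI)
    qed auto
    have 2: "bmat k (UNIV \<times> free_grp S) (free_grp S)
      (\<lambda>i j p y. if fst p = 0 then 0 else a i j (point (fst p - 1) (snd p \<odot> winv y))) D"
    proof (rule bmat_extend_rows[where I' = "(UNIV - {0}) \<times> free_grp S"])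
      show "bmat k ((UNIV - {0}) \<times> free_grp S) (free_grp S)
          (\<lambda>i j p y. if fst p = 0 then 0 else a i j (point (fst p - 1) (snd p \<odot> winv y))) D"
        by (rule bmat_reindex[OF bconv_col[OF T a, of S], of "\<lambda>p. (fst p - 1, snd p)" _ "\<lambda>y. y"]) (auto intro!: inj_onI)
    qed auto
    show "bmat k (UNIV \<times> free_grp S) (free_grp S) (\<lambda>i j p y. ?b i j (point (fst p) (snd p \<odot> winv y))) (4 * D)"
    proof (rule bmat_cong[OF bmat_mono[OF bmat_add[OF 1 2]]])
      fix p y and i j :: nat
      assume "p \<in> (UNIV :: nat set) \<times> free_grp S" "y \<in> free_grp S"
      then show "(if fst p = 0 then a' i j (snd p \<odot> winv y) else 0)
          + (if fst p = 0 then 0 else a i j (point (fst p - 1) (snd p \<odot> winv y)))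
          = ?b i j (point (fst p) (snd p \<odot> winv y))"
        by (cases p; cases "fst p") (auto simp: point_wmult_in_cosets b_0 b_Suc free_grp_closed)
    qed simp
    have 3: "bmat k {()} (UNIV \<times> free_grp S) (\<lambda>i j _ p. if fst p = 0 then a' i j (snd p) else 0) D"
    proof (rule bmat_extend_cols[where J' = "{0} \<times> free_grp S"])
      show "bmat k {()} ({0} \<times> free_grp S) (\<lambda>i j _ p. if fst p = 0 then a' i j (snd p) else 0) D"
        by (rule bmat_reindex[OF bconv_row_all[OF a'], of "\<lambda>_. ()" _ snd]) (auto intro!: inj_onI)
    qed (use D in auto)
    have 4: "bmat k {()} (UNIV \<times> free_grp S) (\<lambda>i j _ p. if fst p = 0 then 0 else a i j (point (fst p - 1) (snd p))) D"
    proof (rule bmat_extend_cols[where J' = "(UNIV - {0}) \<times> free_grp S"])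
      show "bmat k {()} ((UNIV - {0}) \<times> free_grp S)
          (\<lambda>i j _ p. if fst p = 0 then 0 else a i j (point (fst p - 1) (snd p))) D"
        by (rule bmat_reindex[OF bconv_row[OF T a, of S], of "\<lambda>_. ()" _ "\<lambda>p. (fst p - 1, snd p)"]) (auto intro!: inj_onI)
    qed (use D in auto)
    show "bmat k {()} (UNIV \<times> free_grp S) (\<lambda>i j _ p. ?b i j (point (fst p) (snd p))) (4 * D)"
    proof (rule bmat_cong[OF bmat_mono[OF bmat_add[OF 3 4]]])
      fix p and i j :: nat
      assume "p \<in> (UNIV :: nat set) \<times> free_grp S"
      then show "(if fst p = 0 then a' i j (snd p) else 0)
          + (if fst p = 0 then 0 else a i j (point (fst p - 1) (snd p)))
          = ?b i j (point (fst p) (snd p))"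
        by (cases p; cases "fst p") (auto simp: point_in_cosets b_0 b_Suc)
    qed simp
  qed auto
  moreover have "bconv T k (\<lambda>i j v. if v \<in> cosets S then 0 else b i j v) (10 * D)"
    using bconv_off_cosets[OF T D a, of S] unfolding bconv_def
    by (rule bmat_cong) (auto simp: b_off free_grp_closed)
  ultimately show ?thesis using bconv_split by fastforce
qed

text \<open>Hilbert's hotel: the shift empties the coset of h_0, and the second group moves
  in.\<close>

definition tau :: "nat set \<Rightarrow> word + word \<Rightarrow> word" where
  "tau S = case_sum (shift S) (point 0)"

lemma tau_bij:
  assumes T: "{0, 1} \<subseteq> T"
  shows "bij_betw (tau S) (free_grp T <+> free_grp S) (free_grp T)"
proof -
  have shift_cosets: "\<exists>m x. x \<in> free_grp S \<and> v = point m x \<and> shift S v = point (Suc m) x" if "v \<in> cosets S" for v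
    using that unfolding cosets_def using shift_point by blast
  have off: "shift S v = v" if "v \<notin> cosets S" for v using that by (simp add: shift_def)
  have sh: "shift S v = shift S w \<Longrightarrow> v = w" for v w
    using shift_cosets[of v] shift_cosets[of w] off[of v] off[of w] point_in_cosets
    by (metis free_grp_reduced nat.inject point_inj)
  have no: "shift S v \<noteq> point 0 x" if "x \<in> free_grp S" for v x
    using shift_cosets[of v] off[of v] that point_in_cosets by (metis free_grp_reduced nat.distinct(1) point_inj)
  have "inj_on (tau S) (free_grp T <+> free_grp S)"
    using sh no by (auto simp: inj_on_def tau_def dest: point_inj[OF free_grp_reduced free_grp_reduced])
      metis
  moreover have "tau S ` (free_grp T <+> free_grp S) = free_grp T"
  proof
    show "tau S ` (free_grp T <+> free_grp S) \<subseteq> free_grp T"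
      using T by (auto simp: tau_def shift_def point_in_free_grp)
    show "free_grp T \<subseteq> tau S ` (free_grp T <+> free_grp S)"
    proof
      fix v assume v: "v \<in> free_grp T"
      show "v \<in> tau S ` (free_grp T <+> free_grp S)"
      proof (cases "v \<in> cosets S")
        case True
        then obtain m x where mx: "x \<in> free_grp S" "v = point m x" by (auto simp: cosets_def)
        show ?thesis
        proof (cases m)
          case 0
          then show ?thesis using mx by (auto simp: tau_def intro!: image_eqI[of _ _ "Inr x"])
        next
          case (Suc m')
          then show ?thesis using mx T
            by (auto simp: tau_def shift_point point_in_free_grp intro!: image_eqI[of _ _ "Inl (point m' x)"])
        qed
      next
        case False
        then show ?thesis using v by (auto simp: tau_def off intro!: image_eqI[of _ _ "Inl v"])
      qed
    qed
  qed
  ultimately show ?thesis by (simp add: bij_betw_def)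
qed

section \<open>Exchanging the roles of the two groups\<close>

definition swap :: "'a + 'b \<Rightarrow> 'b + 'a" where
  "swap = case_sum Inr Inl"

lemma swap_swap [simp]: "swap (swap x) = x"
  by (cases x) (auto simp: swap_def)

lemma swap_bij: "bij_betw swap (A <+> B) (B <+> A)"
  by (rule bij_betwI[where g = swap]) (auto simp: swap_def split: sum.splits)

text \<open>Each group absorbs a copy of the other, so both are identified with the same disjoint
  union. The formula is symmetric, which is why \<open>rho T S\<close> undoes
  \<open>rho S T\<close>.\<close>

definition rho :: "nat set \<Rightarrow> nat set \<Rightarrow> word \<Rightarrow> word" where
  "rho S T v = tau T (swap (inv_into (free_grp T <+> free_grp S) (tau S) v))"

lemma rho_bij:
  assumes "{0, 1} \<subseteq> S" "{0, 1} \<subseteq> T"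
  shows "bij_betw (rho S T) (free_grp T) (free_grp S)"
  using bij_betw_trans[OF bij_betw_trans[OF bij_betw_inv_into[OF tau_bij[OF assms(2)]] swap_bij] tau_bij[OF assms(1)]]
  by (simp add: rho_def[abs_def] comp_def)

lemma rho_rho:
  assumes "{0, 1} \<subseteq> S" "{0, 1} \<subseteq> T" "v \<in> free_grp T"
  shows "rho T S (rho S T v) = v"
proof -
  note b = tau_bij[OF assms(1), of T] tau_bij[OF assms(2), of S]
  let ?w = "inv_into (free_grp T <+> free_grp S) (tau S) v"
  have "?w \<in> free_grp T <+> free_grp S" "tau S ?w = v"
    using b(2) assms(3) by (auto simp: bij_betw_def intro: inv_into_into f_inv_into_f)
  moreover from this(1) have "swap ?w \<in> free_grp S <+> free_grp T"
    by (rule bij_betw_apply[OF swap_bij])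
  ultimately show ?thesis
    using b(1) by (simp add: rho_def bij_betw_def)
qed

text \<open>Pulling back along \<open>tau T\<close> costs at most 28 on either summand; pulling back
  further along the inverse of \<open>tau S\<close> costs 52.\<close>

lemma bconv_rho:
  assumes S: "{0, 1} \<subseteq> S" and T: "{0, 1} \<subseteq> T" and D: "0 \<le> D" and a: "bconv S k a D"
  shows "bconv T k (\<lambda>i j v. a i j (rho S T v)) (1456 * D)"
proof -
  let ?I = "inv_into (free_grp T <+> free_grp S) (tau S)"
  have inv: "?I (tau S w) = w" if "w \<in> free_grp T <+> free_grp S" for w
    using tau_bij[OF T] that by (simp add: bij_betw_def)
  have D28: "0 \<le> 28 * D" using D by simp
  have "bconv T k (\<lambda>i j v. a i j (rho S T v)) (52 * (28 * D))"
  proof (rule bconv_unshift[OF T D28])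
    show "bconv T k (\<lambda>i j x. a i j (point 0 x)) (28 * D)"
      unfolding bconv_def by (rule bmat_mono[OF bconv_point[OF S a, unfolded bconv_def]]) (use D in simp)
    show "bconv S k (\<lambda>i j v. a i j (shift T v)) (28 * D)"
      by (rule bconv_shift[OF S D a])
  next
    fix v assume v: "v \<in> free_grp T" "v \<notin> cosets S"
    then have "tau S (Inl v) = v" by (simp add: tau_def shift_def)
    then have "?I v = Inl v" using inv[of "Inl v"] v by auto
    then show "a i j (rho S T v) = a i j (point 0 v)" for i j
      by (simp add: rho_def swap_def tau_def)
  next
    fix x assume x: "x \<in> free_grp S"
    have "tau S (Inr x) = point 0 x" by (simp add: tau_def)
    then have "?I (point 0 x) = Inr x" using inv[of "Inr x"] x by auto
    then show "a i j (rho S T (point 0 x)) = a i j (shift T x)" for i j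
      by (simp add: rho_def swap_def tau_def)
  next
    fix x m assume x: "x \<in> free_grp S"
    have "tau S (Inl (point m x)) = point (Suc m) x" using x by (simp add: tau_def shift_point)
    then have "?I (point (Suc m) x) = Inl (point m x)" using inv[of "Inl (point m x)"] point_in_free_grp[OF T] by auto
    then show "a i j (rho S T (point (Suc m) x)) = a i j (point 0 (point m x))" for i j
      by (simp add: rho_def swap_def tau_def)
  qed
  then show ?thesis by simp
qed

section \<open>Convolution operators\<close>

abbreviation bconv1 :: "nat set \<Rightarrow> (word \<Rightarrow> complex) \<Rightarrow> real \<Rightarrow> bool" where
  "bconv1 S a D \<equiv> bconv S 1 (\<lambda>_ _. a) D"

section \<open>Square-summable functions and their finite truncations\<close>

lemma l2norm_sq: "(l2norm G f)\<^sup>2 = (\<Sum>\<^sub>\<infinity>x\<in>G. (cmod (f x))\<^sup>2)"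
  by (simp add: l2norm_def infsum_nonneg)

lemma l2norm_nonneg [simp]: "0 \<le> l2norm G f"
  by (simp add: l2norm_def infsum_nonneg)

lemma l2_summable: "f \<in> l2 G \<Longrightarrow> (\<lambda>x. (cmod (f x))\<^sup>2) summable_on G"
  by (simp add: l2_def)

lemma l2_outside: "f \<in> l2 G \<Longrightarrow> x \<notin> G \<Longrightarrow> f x = 0"
  by (simp add: l2_def)

lemma l2I:
  assumes "\<And>x. x \<notin> G \<Longrightarrow> f x = 0"
    and "\<And>F. finite F \<Longrightarrow> F \<subseteq> G \<Longrightarrow> (\<Sum>x\<in>F. (cmod (f x))\<^sup>2) \<le> B"
  shows "f \<in> l2 G" "(l2norm G f)\<^sup>2 \<le> B"
proof -
  have *: "(\<lambda>x. (cmod (f x))\<^sup>2) summable_on G"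
    by (rule nonneg_bdd_above_summable_on) (use assms(2) in \<open>auto intro!: bdd_aboveI2\<close>)
  then show "f \<in> l2 G" using assms(1) by (simp add: l2_def)
  show "(l2norm G f)\<^sup>2 \<le> B"
    unfolding l2norm_sq using * assms(2) by (intro infsum_le_finite_sums) auto
qed

lemma l2_sum_le:
  assumes "f \<in> l2 G" "finite F" "F \<subseteq> G"
  shows "(\<Sum>x\<in>F. (cmod (f x))\<^sup>2) \<le> (l2norm G f)\<^sup>2"
  unfolding l2norm_sq using assms l2_summable by (intro finite_sum_le_infsum) auto

lemma l2_combination:
  assumes "f \<in> l2 G" "g \<in> l2 G"
  shows "(\<lambda>x. c * f x + g x) \<in> l2 G"
    and "(l2norm G (\<lambda>x. c * f x + g x))\<^sup>2 \<le> 2 * (cmod c)\<^sup>2 * (l2norm G f)\<^sup>2 + 2 * (l2norm G g)\<^sup>2"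
proof -
  have le: "(\<Sum>x\<in>F. (cmod (c * f x + g x))\<^sup>2) \<le> 2 * (cmod c)\<^sup>2 * (l2norm G f)\<^sup>2 + 2 * (l2norm G g)\<^sup>2"
    if F: "finite F" "F \<subseteq> G" for F
  proof -
    have "(\<Sum>x\<in>F. (cmod (c * f x + g x))\<^sup>2) \<le> (\<Sum>x\<in>F. 2 * (cmod c)\<^sup>2 * (cmod (f x))\<^sup>2 + 2 * (cmod (g x))\<^sup>2)"
      using cmod_add_square_le[of "c * f _"] by (intro sum_mono) (simp add: norm_mult power_mult_distrib mult.assoc)
    also have "\<dots> = 2 * (cmod c)\<^sup>2 * (\<Sum>x\<in>F. (cmod (f x))\<^sup>2) + 2 * (\<Sum>x\<in>F. (cmod (g x))\<^sup>2)"
      by (simp add: sum.distrib sum_distrib_left)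
    also have "\<dots> \<le> 2 * (cmod c)\<^sup>2 * (l2norm G f)\<^sup>2 + 2 * (l2norm G g)\<^sup>2"
      by (intro add_mono mult_left_mono l2_sum_le assms F) auto
    finally show ?thesis .
  qed
  have off: "c * f x + g x = 0" if "x \<notin> G" for x
    using assms that by (simp add: l2_outside)
  show "(\<lambda>x. c * f x + g x) \<in> l2 G"
    and "(l2norm G (\<lambda>x. c * f x + g x))\<^sup>2 \<le> 2 * (cmod c)\<^sup>2 * (l2norm G f)\<^sup>2 + 2 * (l2norm G g)\<^sup>2"
    using l2I[of G "\<lambda>x. c * f x + g x", OF off le] by simp_all
qed

lemma l2_zero [simp]: "(\<lambda>_. 0) \<in> l2 G"
  by (rule l2I[where B = 0]) auto

lemma l2_cmult: "f \<in> l2 G \<Longrightarrow> (\<lambda>x. c * f x) \<in> l2 G"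
  using l2_combination(1)[of f G "\<lambda>_. 0" c] by simp

lemma l2norm_cmult: "l2norm G (\<lambda>x. c * f x) = cmod c * l2norm G f"
  by (simp add: l2norm_def norm_mult power_mult_distrib infsum_cmult_right' real_sqrt_mult)

lemma l2norm_zero [simp]: "l2norm G (\<lambda>_. 0) = 0"
  by (simp add: l2norm_def)

lemma l2_point_le: "f \<in> l2 G \<Longrightarrow> x \<in> G \<Longrightarrow> cmod (f x) \<le> l2norm G f"
  using l2_sum_le[of f G "{x}"] by (simp add: abs_le_square_iff[symmetric])

definition restr :: "'a set \<Rightarrow> ('a \<Rightarrow> complex) \<Rightarrow> 'a \<Rightarrow> complex" where
  "restr E f x = (if x \<in> E then f x else 0)"

lemma restr_l2:
  assumes "finite E" "E \<subseteq> G"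
  shows "restr E f \<in> l2 G" "(l2norm G (restr E f))\<^sup>2 = (\<Sum>x\<in>E. (cmod (f x))\<^sup>2)"
proof -
  have le: "(\<Sum>x\<in>F. (cmod (restr E f x))\<^sup>2) \<le> (\<Sum>x\<in>E. (cmod (f x))\<^sup>2)" if "finite F" "F \<subseteq> G" for F
  proof -
    have "(\<Sum>x\<in>F. (cmod (restr E f x))\<^sup>2) = (\<Sum>x\<in>F \<inter> E. (cmod (f x))\<^sup>2)"
      using that by (intro sum.mono_neutral_cong_right) (auto simp: restr_def)
    also have "\<dots> \<le> (\<Sum>x\<in>E. (cmod (f x))\<^sup>2)"
      using assms by (intro sum_mono2) auto
    finally show ?thesis .
  qed
  have off: "restr E f x = 0" if "x \<notin> G" for x using that assms by (auto simp: restr_def)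
  show "restr E f \<in> l2 G" by (rule l2I(1)[OF off le])
  have "(\<Sum>x\<in>E. (cmod (f x))\<^sup>2) = (\<Sum>x\<in>E. (cmod (restr E f x))\<^sup>2)"
    by (simp add: restr_def)
  also have "\<dots> \<le> (l2norm G (restr E f))\<^sup>2"
    using assms \<open>restr E f \<in> l2 G\<close> by (intro l2_sum_le)
  finally show "(l2norm G (restr E f))\<^sup>2 = (\<Sum>x\<in>E. (cmod (f x))\<^sup>2)"
    using l2I(2)[of G "restr E f", OF off le] by simp
qed

lemma l2_tail_le:
  assumes "f \<in> l2 G" "finite E" "E \<subseteq> G"
  shows "(l2norm G (\<lambda>x. (- 1) * restr E f x + f x))\<^sup>2 \<le> (l2norm G f)\<^sup>2 - (\<Sum>x\<in>E. (cmod (f x))\<^sup>2)"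
proof (rule l2I(2))
  fix F assume F: "finite F" "F \<subseteq> G"
  have "(\<Sum>x\<in>F. (cmod ((- 1) * restr E f x + f x))\<^sup>2) = (\<Sum>x\<in>F - E. (cmod (f x))\<^sup>2)"
    using F by (intro sum.mono_neutral_cong_right) (auto simp: restr_def)
  moreover have "(\<Sum>x\<in>F - E. (cmod (f x))\<^sup>2) + (\<Sum>x\<in>E. (cmod (f x))\<^sup>2) = (\<Sum>x\<in>F \<union> E. (cmod (f x))\<^sup>2)"
    using F assms by (subst sum.union_disjoint[symmetric]) (auto intro: arg_cong2[where f = sum])
  moreover have "(\<Sum>x\<in>F \<union> E. (cmod (f x))\<^sup>2) \<le> (l2norm G f)\<^sup>2"
    using F assms by (intro l2_sum_le) auto
  ultimately show "(\<Sum>x\<in>F. (cmod ((- 1) * restr E f x + f x))\<^sup>2) \<le> (l2norm G f)\<^sup>2 - (\<Sum>x\<in>E. (cmod (f x))\<^sup>2)"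
    by linarith
qed (use assms in \<open>auto simp: restr_def l2_outside\<close>)

lemma sum_sq_tendsto:
  "f \<in> l2 G \<Longrightarrow> ((\<lambda>E. \<Sum>x\<in>E. (cmod (f x))\<^sup>2) \<longlongrightarrow> (l2norm G f)\<^sup>2) (finite_subsets_at_top G)"
  unfolding l2norm_sq by (intro infsum_tendsto l2_summable)

definition delta :: "word \<Rightarrow> vec" where
  "delta y x = (if x = y then 1 else 0)"

lemma delta_restr: "delta y = restr {y} (\<lambda>_. 1)"
  by (auto simp: delta_def restr_def)

lemma delta_l2: "y \<in> G \<Longrightarrow> delta y \<in> l2 G"
  by (simp add: delta_restr restr_l2)

lemma delta_l2norm: "y \<in> G \<Longrightarrow> l2norm G (delta y) = 1"
  using restr_l2(2)[of "{y}" G "\<lambda>_. 1"] by (simp add: delta_restr power2_eq_1_iff)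
    (smt (verit) l2norm_nonneg)

section \<open>Bounded operators and their matrix entries\<close>

lemma Bop_outside: "T \<in> Bop G \<Longrightarrow> f \<notin> l2 G \<Longrightarrow> T f = (\<lambda>_. 0)"
  and Bop_l2: "T \<in> Bop G \<Longrightarrow> f \<in> l2 G \<Longrightarrow> T f \<in> l2 G"
  and Bop_linear: "T \<in> Bop G \<Longrightarrow> f \<in> l2 G \<Longrightarrow> g \<in> l2 G \<Longrightarrow> T (\<lambda>x. c * f x + g x) = (\<lambda>x. c * T f x + T g x)"
  by (simp_all add: Bop_def)

lemma Bop_bound:
  assumes "T \<in> Bop G"
  obtains C where "0 \<le> C" "\<And>f. f \<in> l2 G \<Longrightarrow> l2norm G (T f) \<le> C * l2norm G f"
proof -
  obtain C where C: "\<And>f. f \<in> l2 G \<Longrightarrow> l2norm G (T f) \<le> C * l2norm G f"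
    using assms unfolding Bop_def by blast
  have "l2norm G (T f) \<le> max C 0 * l2norm G f" if "f \<in> l2 G" for f
    using C[OF that] mult_right_mono[of C "max C 0" "l2norm G f"] by simp
  then show ?thesis using that[of "max C 0"] by simp
qed

lemma Bop_zero: "T \<in> Bop G \<Longrightarrow> T (\<lambda>_. 0) = (\<lambda>_. 0)"
  using Bop_linear[of T G "\<lambda>_. 0" "\<lambda>_. 0" 1] by (simp add: fun_eq_iff)

lemma Bop_cmult: "T \<in> Bop G \<Longrightarrow> f \<in> l2 G \<Longrightarrow> T (\<lambda>x. c * f x) = (\<lambda>x. c * T f x)"
  using Bop_linear[of T G f "\<lambda>_. 0" c] by (simp add: Bop_zero)

lemma Bop_restr:
  assumes "T \<in> Bop G" "finite E" "E \<subseteq> G"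
  shows "T (restr E f) z = (\<Sum>y\<in>E. f y * T (delta y) z)"
  using assms(2,3)
proof (induction E)
  case empty
  have "restr {} f = (\<lambda>_. 0)" by (auto simp: restr_def)
  then show ?case using Bop_zero[OF assms(1)] by simp
next
  case (insert y E)
  have "restr (insert y E) f = (\<lambda>x. f y * delta y x + restr E f x)"
    using insert by (auto simp: restr_def delta_def)
  then show ?case
    using insert Bop_linear[OF assms(1), of "delta y" "restr E f" "f y"] by (simp add: delta_l2 restr_l2)
qed

text \<open>The tail of \<open>f\<close> outside \<open>E\<close> tends to 0 in norm, and
  boundedness of \<open>T\<close> carries this over to every coordinate.\<close>

lemma Bop_tendsto:
  assumes T: "T \<in> Bop G" and f: "f \<in> l2 G" and z: "z \<in> G"
  shows "((\<lambda>E. T (restr E f) z) \<longlongrightarrow> T f z) (finite_subsets_at_top G)"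
proof -
  obtain C where C: "0 \<le> C" "\<And>f. f \<in> l2 G \<Longrightarrow> l2norm G (T f) \<le> C * l2norm G f"
    using Bop_bound[OF T] by blast
  let ?g = "\<lambda>E. sqrt ((l2norm G f)\<^sup>2 - (\<Sum>x\<in>E. (cmod (f x))\<^sup>2))"
  have "(?g \<longlongrightarrow> sqrt ((l2norm G f)\<^sup>2 - (l2norm G f)\<^sup>2)) (finite_subsets_at_top G)"
    by (intro tendsto_intros sum_sq_tendsto f)
  then have lim: "((\<lambda>E. C * ?g E) \<longlongrightarrow> 0) (finite_subsets_at_top G)"
    by (intro tendsto_mult_right_zero) simp
  have "norm (T (restr E f) z - T f z) \<le> C * ?g E" if E: "finite E" "E \<subseteq> G" for E
  proof -
    let ?h = "\<lambda>x. (- 1) * restr E f x + f x"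
    have h: "?h \<in> l2 G" by (intro l2_combination restr_l2 E f)
    have "norm (T (restr E f) z - T f z) = cmod (T ?h z)"
      using Bop_linear[OF T restr_l2(1)[OF E] f, of "-1"] by (simp add: norm_minus_commute)
    also have "\<dots> \<le> l2norm G (T ?h)"
      by (rule l2_point_le[OF Bop_l2[OF T h] z])
    also have "\<dots> \<le> C * l2norm G ?h" by (rule C(2)[OF h])
    also have "\<dots> \<le> C * ?g E"
      using l2_tail_le[OF f E] C(1) by (intro mult_left_mono real_le_rsqrt) auto
    finally show ?thesis .
  qed
  then have "((\<lambda>E. T (restr E f) z - T f z) \<longlongrightarrow> 0) (finite_subsets_at_top G)"
    by (intro Lim_null_comparison[OF _ lim] eventually_finite_subsets_at_top_weakI)
  then show ?thesis by (rule LIM_zero_cancel)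
qed

lemma Bop_bconv1:
  assumes T: "T \<in> Bop (free_grp S)"
    and D: "\<And>f. f \<in> l2 (free_grp S) \<Longrightarrow> (l2norm (free_grp S) (T f))\<^sup>2 \<le> D * (l2norm (free_grp S) f)\<^sup>2"
    and a: "\<And>y z. y \<in> free_grp S \<Longrightarrow> z \<in> free_grp S \<Longrightarrow> T (delta y) z = a (z \<odot> winv y)"
  shows "bconv1 S a D"
  unfolding bconv_def
proof (rule bmatI)
  fix F E and f :: "word \<Rightarrow> nat \<Rightarrow> complex"
  assume *: "finite F" "F \<subseteq> free_grp S" "finite E" "E \<subseteq> free_grp S"
  let ?f = "restr E (\<lambda>q. f q 0)"
  note f = restr_l2[OF *(3,4), of "\<lambda>q. f q 0"]
  have "(\<Sum>y\<in>E. a (z \<odot> winv y) * f y 0) = T ?f z" if "z \<in> F" for z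
    unfolding Bop_restr[OF T *(3,4)] using * that by (intro sum.cong) (auto simp: subset_iff a)
  then have "(\<Sum>z\<in>F. (cmod (\<Sum>y\<in>E. a (z \<odot> winv y) * f y 0))\<^sup>2) = (\<Sum>z\<in>F. (cmod (T ?f z))\<^sup>2)"
    by simp
  also have "\<dots> \<le> (l2norm (free_grp S) (T ?f))\<^sup>2"
    by (rule l2_sum_le[OF Bop_l2[OF T f(1)] *(1,2)])
  also have "\<dots> \<le> D * (\<Sum>y\<in>E. (cmod (f y 0))\<^sup>2)"
    using D[OF f(1)] f(2) by simp
  finally show "(\<Sum>p\<in>F. \<Sum>i<1::nat. (cmod (\<Sum>q\<in>E. \<Sum>j<1. a (p \<odot> winv q) * f q j))\<^sup>2)
      \<le> D * (\<Sum>q\<in>E. \<Sum>j<1. (cmod (f q j))\<^sup>2)" by simp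
qed

section \<open>From bounded matrices to convolution operators\<close>

text \<open>Feed in vectors living in coordinate \<open>j\<close> and keep output coordinate
  \<open>i\<close>.\<close>

lemma bconv_entry:
  assumes "bconv S k a D" "i < k" "j < k"
  shows "bconv1 S (a i j) D"
  unfolding bconv_def
proof (rule bmatI)
  fix F E and f :: "word \<Rightarrow> nat \<Rightarrow> complex"
  assume *: "finite F" "F \<subseteq> free_grp S" "finite E" "E \<subseteq> free_grp S"
  let ?f = "\<lambda>q l. if l = j then f q 0 else 0"
  have s: "(\<Sum>l<k. g l * (if l = j then x else 0)) = g j * x" for g and x :: complex
    using assms(3) by (simp add: if_distrib cong: if_cong)
  have "(\<Sum>p\<in>F. (cmod (\<Sum>q\<in>E. a i j (p \<odot> winv q) * f q 0))\<^sup>2)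
      \<le> (\<Sum>p\<in>F. \<Sum>i<k. (cmod (\<Sum>q\<in>E. a i j (p \<odot> winv q) * f q 0))\<^sup>2)"
    using assms(2) by (intro sum_mono member_le_sum) auto
  also have "\<dots> \<le> D * (\<Sum>q\<in>E. \<Sum>l<k. (cmod (?f q l))\<^sup>2)"
    using bmatD[OF assms(1)[unfolded bconv_def] *, of ?f] by (simp only: s)
  also have "(\<Sum>q\<in>E. \<Sum>l<k. (cmod (?f q l))\<^sup>2) = (\<Sum>q\<in>E. (cmod (f q 0))\<^sup>2)"
    using assms(3) by (simp add: if_distrib[of "\<lambda>x. (cmod x)\<^sup>2"] cong: if_cong)
  finally show "(\<Sum>p\<in>F. \<Sum>i'<1::nat. (cmod (\<Sum>q\<in>E. \<Sum>j'<1. a i j (p \<odot> winv q) * f q j'))\<^sup>2)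
      \<le> D * (\<Sum>q\<in>E. \<Sum>j<1. (cmod (f q j))\<^sup>2)" by simp
qed

definition conv :: "nat set \<Rightarrow> (word \<Rightarrow> complex) \<Rightarrow> op" where
  "conv S a f z = (if f \<in> l2 (free_grp S) \<and> z \<in> free_grp S
     then \<Sum>\<^sub>\<infinity>y\<in>free_grp S. a (z \<odot> winv y) * f y else 0)"

lemma bconv1_row_le:
  assumes "bconv1 S a D" "z \<in> free_grp S" "finite E" "E \<subseteq> free_grp S"
  shows "(\<Sum>y\<in>E. (cmod (a (z \<odot> winv y)))\<^sup>2) \<le> \<bar>D\<bar>"
proof -
  let ?s = "\<Sum>y\<in>E. (cmod (a (z \<odot> winv y)))\<^sup>2"
  have s: "complex_of_real ?s = (\<Sum>y\<in>E. a (z \<odot> winv y) * cnj (a (z \<odot> winv y)))"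
    by (simp only: complex_norm_square[symmetric] of_real_sum)
  then have "(cmod (\<Sum>y\<in>E. a (z \<odot> winv y) * cnj (a (z \<odot> winv y))))\<^sup>2 = ?s\<^sup>2"
    by (simp only: s[symmetric] norm_of_real power2_abs)
  \<comment> \<open>The row is tested against its own conjugate; dividing by the sum then bounds
    it.\<close>
  then have "?s\<^sup>2 \<le> D * ?s"
    using bmatD[OF assms(1)[unfolded bconv_def] _ _ assms(3,4), of "{z}" "\<lambda>y _. cnj (a (z \<odot> winv y))"] assms(2)
    by simp
  moreover have "0 \<le> ?s" by (intro sum_nonneg) auto
  ultimately show ?thesis
    by (cases "?s = 0") (auto simp: power2_eq_square)
qed

lemma conv_summable:
  assumes "bconv1 S a D" "z \<in> free_grp S" "f \<in> l2 (free_grp S)"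
  shows "(\<lambda>y. a (z \<odot> winv y) * f y) summable_on free_grp S"
proof (rule abs_summable_summable, rule nonneg_bdd_above_summable_on)
  show "bdd_above (sum (\<lambda>y. norm (a (z \<odot> winv y) * f y)) ` {F. F \<subseteq> free_grp S \<and> finite F})"
  proof (rule bdd_aboveI2)
    fix E assume "E \<in> {F. F \<subseteq> free_grp S \<and> finite F}"
    then have E: "finite E" "E \<subseteq> free_grp S" by auto
    have "norm (a (z \<odot> winv y) * f y) \<le> (cmod (a (z \<odot> winv y)))\<^sup>2 + (cmod (f y))\<^sup>2" for y
      using sum_squares_bound[of "cmod (a (z \<odot> winv y))" "cmod (f y)"]
        mult_nonneg_nonneg[OF norm_ge_zero norm_ge_zero, of "a (z \<odot> winv y)" "f y"]
      unfolding norm_mult by linarith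
    then have "(\<Sum>y\<in>E. norm (a (z \<odot> winv y) * f y)) \<le> (\<Sum>y\<in>E. (cmod (a (z \<odot> winv y)))\<^sup>2) + (\<Sum>y\<in>E. (cmod (f y))\<^sup>2)"
      by (simp add: sum_mono flip: sum.distrib)
    also have "\<dots> \<le> \<bar>D\<bar> + (l2norm (free_grp S) f)\<^sup>2"
      by (intro add_mono bconv1_row_le[OF assms(1,2)] l2_sum_le assms E)
    finally show "(\<Sum>y\<in>E. norm (a (z \<odot> winv y) * f y)) \<le> \<bar>D\<bar> + (l2norm (free_grp S) f)\<^sup>2" .
  qed
qed simp

lemma conv_tendsto:
  assumes "bconv1 S a D" "z \<in> free_grp S" "f \<in> l2 (free_grp S)"
  shows "((\<lambda>E. \<Sum>y\<in>E. a (z \<odot> winv y) * f y) \<longlongrightarrow> conv S a f z) (finite_subsets_at_top (free_grp S))"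
  using infsum_tendsto[OF conv_summable[OF assms]] assms by (simp add: conv_def)

lemma conv_outside: "z \<notin> free_grp S \<Longrightarrow> conv S a f z = 0"
  by (simp add: conv_def)

text \<open>The finite test inequality survives when the column set exhausts the group; the row set
  is exhausted afterwards, in \<open>conv_matrix_le\<close>.\<close>

lemma conv_matrix_sum_le:
  assumes a: "bconv S k a D" and fs: "\<And>j. j < k \<Longrightarrow> fs j \<in> l2 (free_grp S)"
    and F: "finite F" "F \<subseteq> free_grp S"
  shows "(\<Sum>z\<in>F. \<Sum>i<k. (cmod (\<Sum>j<k. conv S (a i j) (fs j) z))\<^sup>2) \<le> D * (\<Sum>j<k. (l2norm (free_grp S) (fs j))\<^sup>2)"
proof (rule tendsto_le)
  let ?FF = "finite_subsets_at_top (free_grp S)"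
  show "?FF \<noteq> bot" by simp
  show "((\<lambda>E. \<Sum>z\<in>F. \<Sum>i<k. (cmod (\<Sum>j<k. \<Sum>y\<in>E. a i j (z \<odot> winv y) * fs j y))\<^sup>2) \<longlongrightarrow>
      (\<Sum>z\<in>F. \<Sum>i<k. (cmod (\<Sum>j<k. conv S (a i j) (fs j) z))\<^sup>2)) ?FF"
    using F by (intro tendsto_intros conv_tendsto[OF bconv_entry[OF a]] fs) auto
  show "((\<lambda>E. D * (\<Sum>j<k. \<Sum>y\<in>E. (cmod (fs j y))\<^sup>2)) \<longlongrightarrow> D * (\<Sum>j<k. (l2norm (free_grp S) (fs j))\<^sup>2)) ?FF"
    by (intro tendsto_intros sum_sq_tendsto fs) auto
  show "\<forall>\<^sub>F E in ?FF. (\<Sum>z\<in>F. \<Sum>i<k. (cmod (\<Sum>j<k. \<Sum>y\<in>E. a i j (z \<odot> winv y) * fs j y))\<^sup>2)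
      \<le> D * (\<Sum>j<k. \<Sum>y\<in>E. (cmod (fs j y))\<^sup>2)"
  proof (rule eventually_finite_subsets_at_top_weakI)
    fix E assume "finite E" "E \<subseteq> free_grp S"
    from bmatD[OF a[unfolded bconv_def] F this, of "\<lambda>y j. fs j y"]
    show "(\<Sum>z\<in>F. \<Sum>i<k. (cmod (\<Sum>j<k. \<Sum>y\<in>E. a i j (z \<odot> winv y) * fs j y))\<^sup>2)
      \<le> D * (\<Sum>j<k. \<Sum>y\<in>E. (cmod (fs j y))\<^sup>2)"
      by (simp only: sum.swap[of _ _ E])
  qed
qed

lemma conv_matrix_le:
  assumes a: "bconv S k a D" and fs: "\<And>j. j < k \<Longrightarrow> fs j \<in> l2 (free_grp S)"
  shows "\<And>i. i < k \<Longrightarrow> (\<lambda>z. \<Sum>j<k. conv S (a i j) (fs j) z) \<in> l2 (free_grp S)"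
    and "(\<Sum>i<k. (l2norm (free_grp S) (\<lambda>z. \<Sum>j<k. conv S (a i j) (fs j) z))\<^sup>2)
      \<le> D * (\<Sum>j<k. (l2norm (free_grp S) (fs j))\<^sup>2)"
proof -
  let ?g = "\<lambda>i z. \<Sum>j<k. conv S (a i j) (fs j) z"
  let ?B = "D * (\<Sum>j<k. (l2norm (free_grp S) (fs j))\<^sup>2)"
  show l2: "?g i \<in> l2 (free_grp S)" if "i < k" for i
  proof (rule l2I(1))
    fix F assume F: "finite F" "F \<subseteq> free_grp S"
    have "(\<Sum>z\<in>F. (cmod (?g i z))\<^sup>2) \<le> (\<Sum>z\<in>F. \<Sum>i<k. (cmod (?g i z))\<^sup>2)"
      using that by (intro sum_mono member_le_sum) auto
    also have "\<dots> \<le> ?B" by (rule conv_matrix_sum_le[OF a fs F])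
    finally show "(\<Sum>z\<in>F. (cmod (?g i z))\<^sup>2) \<le> ?B" .
  qed (simp add: conv_outside)
  show "(\<Sum>i<k. (l2norm (free_grp S) (?g i))\<^sup>2) \<le> ?B"
  proof (rule tendsto_upperbound)
    show "((\<lambda>F. \<Sum>i<k. \<Sum>z\<in>F. (cmod (?g i z))\<^sup>2) \<longlongrightarrow> (\<Sum>i<k. (l2norm (free_grp S) (?g i))\<^sup>2))
      (finite_subsets_at_top (free_grp S))"
      by (intro tendsto_intros sum_sq_tendsto l2) auto
    show "\<forall>\<^sub>F F in finite_subsets_at_top (free_grp S). (\<Sum>i<k. \<Sum>z\<in>F. (cmod (?g i z))\<^sup>2) \<le> ?B"
    proof (rule eventually_finite_subsets_at_top_weakI)
      fix F assume "finite F" "F \<subseteq> free_grp S"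
      from conv_matrix_sum_le[OF a fs this] show "(\<Sum>i<k. \<Sum>z\<in>F. (cmod (?g i z))\<^sup>2) \<le> ?B"
        by (subst sum.swap)
    qed
  qed simp
qed

lemma conv_linear:
  assumes "bconv1 S a D" "f \<in> l2 (free_grp S)" "g \<in> l2 (free_grp S)"
  shows "conv S a (\<lambda>x. c * f x + g x) = (\<lambda>x. c * conv S a f x + conv S a g x)"
proof
  fix z
  show "conv S a (\<lambda>x. c * f x + g x) z = c * conv S a f z + conv S a g z"
  proof (cases "z \<in> free_grp S")
    case True
    let ?h = "\<lambda>x. c * f x + g x"
    have h: "?h \<in> l2 (free_grp S)" by (intro l2_combination assms)
    have "((\<lambda>E. c * (\<Sum>y\<in>E. a (z \<odot> winv y) * f y) + (\<Sum>y\<in>E. a (z \<odot> winv y) * g y))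
        \<longlongrightarrow> c * conv S a f z + conv S a g z) (finite_subsets_at_top (free_grp S))"
      by (intro tendsto_intros conv_tendsto[OF assms(1) True] assms)
    moreover have "(\<lambda>E. c * (\<Sum>y\<in>E. a (z \<odot> winv y) * f y) + (\<Sum>y\<in>E. a (z \<odot> winv y) * g y))
      = (\<lambda>E. \<Sum>y\<in>E. a (z \<odot> winv y) * ?h y)"
      by (simp add: sum_distrib_left algebra_simps flip: sum.distrib)
    ultimately have "((\<lambda>E. \<Sum>y\<in>E. a (z \<odot> winv y) * ?h y)
        \<longlongrightarrow> c * conv S a f z + conv S a g z) (finite_subsets_at_top (free_grp S))"
      by (simp only:)
    from tendsto_unique[OF finite_subsets_at_top_neq_bot conv_tendsto[OF assms(1) True h] this]
    show ?thesis .
  qed (simp add: conv_outside)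
qed

lemma conv_Bop:
  assumes "bconv1 S a D" "0 \<le> D"
  shows "conv S a \<in> Bop (free_grp S)"
    and "f \<in> l2 (free_grp S) \<Longrightarrow> l2norm (free_grp S) (conv S a f) \<le> sqrt D * l2norm (free_grp S) f"
proof -
  have l2: "conv S a f \<in> l2 (free_grp S)" if "f \<in> l2 (free_grp S)" for f
    using conv_matrix_le(1)[OF assms(1), of "\<lambda>_. f" 0] that by simp
  have le: "l2norm (free_grp S) (conv S a f) \<le> sqrt D * l2norm (free_grp S) f" if "f \<in> l2 (free_grp S)" for f
  proof -
    have "(l2norm (free_grp S) (conv S a f))\<^sup>2 \<le> D * (l2norm (free_grp S) f)\<^sup>2"
      using conv_matrix_le(2)[OF assms(1), of "\<lambda>_. f"] that by simp
    then have "sqrt ((l2norm (free_grp S) (conv S a f))\<^sup>2) \<le> sqrt (D * (l2norm (free_grp S) f)\<^sup>2)"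
      by (rule real_sqrt_le_mono)
    then show ?thesis by (simp add: real_sqrt_mult)
  qed
  then show "f \<in> l2 (free_grp S) \<Longrightarrow> l2norm (free_grp S) (conv S a f) \<le> sqrt D * l2norm (free_grp S) f" .
  have "conv S a f = (\<lambda>_. 0)" if "f \<notin> l2 (free_grp S)" for f
    using that by (simp add: conv_def fun_eq_iff)
  then show "conv S a \<in> Bop (free_grp S)"
    unfolding Bop_def mem_Collect_eq
    using l2 le conv_linear[OF assms(1)] by (intro conjI exI[of _ "sqrt D"]; simp)
qed

lemma conv_delta:
  assumes "z \<in> free_grp S" "y \<in> free_grp S"
  shows "conv S a (delta y) z = a (z \<odot> winv y)"
proof -
  have "(\<Sum>\<^sub>\<infinity>w\<in>free_grp S. a (z \<odot> winv w) * delta y w) = (\<Sum>\<^sub>\<infinity>w\<in>{y}. a (z \<odot> winv w) * delta y w)"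
    using assms by (intro infsum_cong_neutral) (auto simp: delta_def)
  then show ?thesis using assms by (simp add: conv_def delta_l2) (simp add: delta_def)
qed

text \<open>Finite truncations are combinations of basis vectors, so the matrix determines the
  operator on them, and \<open>Bop_tendsto\<close> extends this to all vectors.\<close>

lemma Bop_eq_conv:
  assumes T: "T \<in> Bop (free_grp S)"
    and a: "\<And>y z. y \<in> free_grp S \<Longrightarrow> z \<in> free_grp S \<Longrightarrow> T (delta y) z = a (z \<odot> winv y)"
  shows "T = conv S a"
proof (intro ext)
  fix f z
  obtain C where C: "0 \<le> C" "\<And>f. f \<in> l2 (free_grp S) \<Longrightarrow> l2norm (free_grp S) (T f) \<le> C * l2norm (free_grp S) f"
    using Bop_bound[OF T] by blast
  \<comment> \<open>Boundedness of \<open>T\<close> makes the series defining \<open>conv\<close>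
    converge.\<close>
  have cb: "bconv1 S a (C\<^sup>2)"
    using power_mono[OF C(2)] by (intro Bop_bconv1[OF T] a) (auto simp: power_mult_distrib)
  show "T f z = conv S a f z"
  proof (cases "f \<in> l2 (free_grp S) \<and> z \<in> free_grp S")
    case True
    have "T (restr E f) z = (\<Sum>y\<in>E. a (z \<odot> winv y) * f y)" if "finite E" "E \<subseteq> free_grp S" for E
      unfolding Bop_restr[OF T that] using that True by (intro sum.cong) (auto simp: a subset_iff)
    then have "\<forall>\<^sub>F E in finite_subsets_at_top (free_grp S). T (restr E f) z = (\<Sum>y\<in>E. a (z \<odot> winv y) * f y)"
      by (rule eventually_finite_subsets_at_top_weakI)
    from Bop_tendsto[OF T, THEN iffD1[OF tendsto_cong[OF this]]]
    have "((\<lambda>E. \<Sum>y\<in>E. a (z \<odot> winv y) * f y) \<longlongrightarrow> T f z) (finite_subsets_at_top (free_grp S))"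
      using True by blast
    from tendsto_unique[OF finite_subsets_at_top_neq_bot this conv_tendsto[OF cb]] show ?thesis
      using True by blast
  next
    case False
    then show ?thesis
      using Bop_outside[OF T, of f] l2_outside[OF Bop_l2[OF T, of f], of z]
      by (cases "f \<in> l2 (free_grp S)") (auto simp: conv_def)
  qed
qed

section \<open>Matrix norms and operator norms as suprema\<close>

lemma conv_matnorm_set_le:
  assumes a: "bconv S k a D" and D: "0 \<le> D"
    and "x \<in> {sqrt (\<Sum>i<k. (l2norm (free_grp S) (\<lambda>z. \<Sum>j<k. conv S (a i j) (fs j) z))^2) | fs.
       (\<forall>j<k. fs j \<in> l2 (free_grp S)) \<and> (\<Sum>j<k. (l2norm (free_grp S) (fs j))^2) \<le> 1}"
  shows "x \<le> sqrt D"
proof -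
  obtain fs where x: "x = sqrt (\<Sum>i<k. (l2norm (free_grp S) (\<lambda>z. \<Sum>j<k. conv S (a i j) (fs j) z))^2)"
    and fs: "\<And>j. j < k \<Longrightarrow> fs j \<in> l2 (free_grp S)" "(\<Sum>j<k. (l2norm (free_grp S) (fs j))^2) \<le> 1"
    using assms(3) by auto
  have "(\<Sum>i<k. (l2norm (free_grp S) (\<lambda>z. \<Sum>j<k. conv S (a i j) (fs j) z))^2)
      \<le> D * (\<Sum>j<k. (l2norm (free_grp S) (fs j))\<^sup>2)"
    by (rule conv_matrix_le(2)[OF a fs(1)])
  also have "\<dots> \<le> D * 1" using fs(2) D by (rule mult_left_mono)
  finally show ?thesis by (simp add: x)
qed

lemma matnorm_conv_le:
  assumes "bconv S k a D" "0 \<le> D"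
  shows "matnorm (free_grp S) k (\<lambda>i j. conv S (a i j)) \<le> sqrt D"
  unfolding matnorm_def
  by (rule cSup_least[OF _ conv_matnorm_set_le[OF assms]]) (auto intro!: exI[of _ "\<lambda>_ _. 0"])

text \<open>Any finite bound \<open>D\<close> makes the supremum genuine. Testing on normalised
  finite vectors then improves \<open>D\<close> to the square of the matrix norm itself.\<close>

lemma matnorm_conv:
  assumes a: "bconv S k a D" and D: "0 \<le> D"
  defines "N \<equiv> matnorm (free_grp S) k (\<lambda>i j. conv S (a i j))"
  shows "0 \<le> N" "bconv S k a (N\<^sup>2)"
proof -
  let ?n = "\<lambda>fs. sqrt (\<Sum>i<k. (l2norm (free_grp S) (\<lambda>z. \<Sum>j<k. conv S (a i j) (fs j) z))\<^sup>2)"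
  have up: "?n fs \<le> N" if "\<And>j. j < k \<Longrightarrow> fs j \<in> l2 (free_grp S)" "(\<Sum>j<k. (l2norm (free_grp S) (fs j))\<^sup>2) \<le> 1" for fs
    unfolding N_def matnorm_def using that conv_matnorm_set_le[OF a D]
    by (intro cSup_upper bdd_aboveI[of _ "sqrt D"]) blast+
  have "0 \<le> ?n (\<lambda>_ _. 0)" by (simp add: sum_nonneg)
  also have "\<dots> \<le> N" by (rule up) auto
  finally show N: "0 \<le> N" .
  show "bconv S k a (N\<^sup>2)"
    unfolding bconv_def
  proof (rule bmatI)
    fix F E and f :: "word \<Rightarrow> nat \<Rightarrow> complex"
    assume *: "finite F" "F \<subseteq> free_grp S" "finite E" "E \<subseteq> free_grp S"
    define t where "t = sqrt (\<Sum>q\<in>E. \<Sum>j<k. (cmod (f q j))\<^sup>2)"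
    have t2: "t\<^sup>2 = (\<Sum>q\<in>E. \<Sum>j<k. (cmod (f q j))\<^sup>2)"
      unfolding t_def by (intro real_sqrt_pow2 sum_nonneg) auto
    let ?L = "\<lambda>f. \<Sum>p\<in>F. \<Sum>i<k. (cmod (\<Sum>q\<in>E. \<Sum>j<k. a i j (p \<odot> winv q) * f q j))\<^sup>2"
    show "?L f \<le> N\<^sup>2 * (\<Sum>q\<in>E. \<Sum>j<k. (cmod (f q j))\<^sup>2)"
    proof (cases "t = 0")
      case True
      \<comment> \<open>A zero vector cannot be normalised; the given bound shows that the left side
        is then at most 0.\<close>
      then show ?thesis
        using bmatD[OF a[unfolded bconv_def] *, of f] t2 by simp
    next
      case False
      let ?g = "\<lambda>q j. f q j / of_real t"
      let ?fs = "\<lambda>j. restr E (\<lambda>q. ?g q j)"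
      note fs = restr_l2[OF *(3,4)]
      have eq: "conv S (a i j) (?fs j) z = (\<Sum>q\<in>E. a i j (z \<odot> winv q) * ?g q j)"
        if "i < k" "j < k" "z \<in> F" for i j z
        unfolding Bop_restr[OF conv_Bop(1)[OF bconv_entry[OF a that(1,2)] D] *(3,4)]
        using that * by (intro sum.cong) (auto simp: conv_delta subset_iff)
      have "?L ?g = (\<Sum>p\<in>F. \<Sum>i<k. (cmod (\<Sum>j<k. conv S (a i j) (?fs j) p))\<^sup>2)"
        by (simp add: eq sum.swap[of _ _ E])
      also have "\<dots> = (\<Sum>i<k. \<Sum>p\<in>F. (cmod (\<Sum>j<k. conv S (a i j) (?fs j) p))\<^sup>2)"
        by (rule sum.swap)
      also have "\<dots> \<le> (\<Sum>i<k. (l2norm (free_grp S) (\<lambda>z. \<Sum>j<k. conv S (a i j) (?fs j) z))\<^sup>2)"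
        using * by (intro sum_mono l2_sum_le conv_matrix_le(1)[OF a] fs) auto
      also have "\<dots> = (?n ?fs)\<^sup>2" by (simp add: sum_nonneg)
      also have "\<dots> \<le> N\<^sup>2"
      proof (intro power_mono up)
        have "(\<Sum>j<k. (l2norm (free_grp S) (?fs j))\<^sup>2) = (\<Sum>q\<in>E. \<Sum>j<k. (cmod (f q j))\<^sup>2) / t\<^sup>2"
          by (simp add: fs(2) sum.swap[of _ _ E] norm_divide power_divide sum_divide_distrib)
        then show "(\<Sum>j<k. (l2norm (free_grp S) (?fs j))\<^sup>2) \<le> 1" by (simp add: t2[symmetric])
      qed (auto simp: fs sum_nonneg)
      finally have "?L ?g \<le> N\<^sup>2" .
      moreover have "?L ?g = ?L f / t\<^sup>2"
        by (simp add: sum_divide_distrib[symmetric] norm_divide power_divide)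
      ultimately have "?L f / t\<^sup>2 \<le> N\<^sup>2" by simp
      then show ?thesis using False by (simp add: t2[symmetric] pos_divide_le_eq)
    qed
  qed
qed

lemma matnorm_cong:
  assumes "\<And>i j. i < k \<Longrightarrow> j < k \<Longrightarrow> M i j = M' i j"
  shows "matnorm G k M = matnorm G k M'"
  unfolding matnorm_def using assms by simp

lemma opnorm_upper:
  assumes X: "X \<in> Bop G" and f: "f \<in> l2 G"
  shows "l2norm G (X f) \<le> opnorm G X * l2norm G f"
proof -
  obtain C where C: "0 \<le> C" "\<And>f. f \<in> l2 G \<Longrightarrow> l2norm G (X f) \<le> C * l2norm G f"
    using Bop_bound[OF X] by blast
  show ?thesis
  proof (cases "l2norm G f = 0")
    case True
    then show ?thesis using C(2)[OF f] by simp
  next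
    case False
    let ?c = "complex_of_real (1 / l2norm G f)"
    have "bdd_above {l2norm G (X f) | f. f \<in> l2 G \<and> l2norm G f \<le> 1}"
    proof (rule bdd_aboveI)
      fix x assume "x \<in> {l2norm G (X f) | f. f \<in> l2 G \<and> l2norm G f \<le> 1}"
      then obtain g where "x = l2norm G (X g)" "g \<in> l2 G" "l2norm G g \<le> 1" by auto
      then show "x \<le> C" using C(2)[of g] mult_left_mono[of "l2norm G g" 1 C] C(1) by simp
    qed
    moreover have "l2norm G (\<lambda>x. ?c * f x) = 1"
      using False by (simp only: l2norm_cmult norm_of_real) simp
    ultimately have "l2norm G (X (\<lambda>x. ?c * f x)) \<le> opnorm G X"
      unfolding opnorm_def using l2_cmult[OF f, of ?c]
      by (intro cSup_upper CollectI exI[of _ "\<lambda>x. ?c * f x"]) (simp_all only: order_refl simp_thms)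
    then show ?thesis
      unfolding Bop_cmult[OF X f] l2norm_cmult norm_of_real
      using False l2norm_nonneg[of G f] by (simp add: field_simps del: l2norm_nonneg)
  qed
qed

lemma opnorm_least:
  assumes "\<And>f. f \<in> l2 G \<Longrightarrow> l2norm G (X f) \<le> B * l2norm G f" "0 \<le> B"
  shows "opnorm G X \<le> B"
  unfolding opnorm_def
proof (rule cSup_least)
  show "{l2norm G (X f) | f. f \<in> l2 G \<and> l2norm G f \<le> 1} \<noteq> {}"
    using l2_zero[of G] l2norm_zero[of G] by fastforce
  fix x assume "x \<in> {l2norm G (X f) | f. f \<in> l2 G \<and> l2norm G f \<le> 1}"
  then obtain g where "x = l2norm G (X g)" "g \<in> l2 G" "l2norm G g \<le> 1" by auto
  then show "x \<le> B" using assms(1)[of g] mult_left_mono[of "l2norm G g" 1 B] assms(2) by simp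
qed

lemma Bop_diff:
  assumes "T \<in> Bop G" "T' \<in> Bop G"
  shows "(\<lambda>f z. T f z - T' f z) \<in> Bop G"
proof -
  obtain C where C: "0 \<le> C" "\<And>f. f \<in> l2 G \<Longrightarrow> l2norm G (T f) \<le> C * l2norm G f"
    using Bop_bound[OF assms(1)] by blast
  obtain C' where C': "0 \<le> C'" "\<And>f. f \<in> l2 G \<Longrightarrow> l2norm G (T' f) \<le> C' * l2norm G f"
    using Bop_bound[OF assms(2)] by blast
  have "l2norm G (\<lambda>z. T f z - T' f z) \<le> sqrt (2 * C'\<^sup>2 + 2 * C\<^sup>2) * l2norm G f" if f: "f \<in> l2 G" for f
  proof (rule power2_le_imp_le)
    have "(l2norm G (\<lambda>z. T f z - T' f z))\<^sup>2 \<le> 2 * (l2norm G (T' f))\<^sup>2 + 2 * (l2norm G (T f))\<^sup>2"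
      using l2_combination(2)[OF Bop_l2[OF assms(2) f] Bop_l2[OF assms(1) f], of "-1"] by simp
    also have "\<dots> \<le> 2 * (C' * l2norm G f)\<^sup>2 + 2 * (C * l2norm G f)\<^sup>2"
      by (intro add_mono mult_left_mono power_mono C(2) C'(2) f) auto
    finally show "(l2norm G (\<lambda>z. T f z - T' f z))\<^sup>2 \<le> (sqrt (2 * C'\<^sup>2 + 2 * C\<^sup>2) * l2norm G f)\<^sup>2"
      by (simp add: power_mult_distrib algebra_simps)
  qed (simp add: C C')
  moreover have "(\<lambda>z. T f z - T' f z) \<in> l2 G" if "f \<in> l2 G" for f
    using l2_combination(1)[OF Bop_l2[OF assms(2) that] Bop_l2[OF assms(1) that], of "-1"] by simp
  ultimately show ?thesis
    unfolding Bop_def mem_Collect_eq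
    by (intro conjI exI[of _ "sqrt (2 * C'\<^sup>2 + 2 * C\<^sup>2)"] ballI allI impI)
      (simp_all add: Bop_outside[OF assms(1)] Bop_outside[OF assms(2)] Bop_linear[OF assms(1)]
        Bop_linear[OF assms(2)] right_diff_distrib add_diff_add)
qed

section \<open>Finite combinations of translations\<close>

text \<open>Translation by \<open>x\<close> is a permutation matrix: labelling row \<open>z\<close>
  by \<open>winv x \<odot> z\<close> leaves blocks of size at most one.\<close>

lemma bconv1_single: "bconv1 S (\<lambda>v. if v = x then c else 0) ((cmod c)\<^sup>2)" if x: "x \<in> free_grp S"
proof -
  have "bmat 1 (free_grp S) (free_grp S) (\<lambda>i j z y. if z \<odot> winv y = x then 1 else 0) 1"
  proof (rule bmat_block[where r = "\<lambda>z. winv x \<odot> z" and s = "\<lambda>y. y"])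
    fix \<rho>
    show "bmat 1 {z \<in> free_grp S. winv x \<odot> z = \<rho>} {y \<in> free_grp S. y = \<rho>} (\<lambda>i j z y. if z \<odot> winv y = x then 1 else 0) 1"
    proof (rule bmatI)
      fix F E and f :: "word \<Rightarrow> nat \<Rightarrow> complex"
      assume *: "finite F" "F \<subseteq> {z \<in> free_grp S. winv x \<odot> z = \<rho>}" "finite E" "E \<subseteq> {y \<in> free_grp S. y = \<rho>}"
      have "F \<subseteq> {x \<odot> \<rho>}"
        using *(2) wmult_winv_cancel[of _ x] free_grp_reduced by fastforce
      then have F: "F = {} \<or> F = {x \<odot> \<rho>}" by auto
      have E: "E = {} \<or> E = {\<rho>}" using * by auto
      show "(\<Sum>p\<in>F. \<Sum>i<1::nat. (cmod (\<Sum>q\<in>E. \<Sum>j<1. (if p \<odot> winv q = x then 1 else 0) * f q j))\<^sup>2)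
          \<le> 1 * (\<Sum>q\<in>E. \<Sum>j<1. (cmod (f q j))\<^sup>2)"
        using F E by auto
    qed
  next
    fix z y and i j :: nat
    assume "z \<in> free_grp S" "y \<in> free_grp S" "winv x \<odot> z \<noteq> y"
    then have "z \<odot> winv y \<noteq> x"
      using wmult_winv_eq[of x y z] winv_wmult_cancel[of y x] x free_grp_reduced by metis
    then show "(if z \<odot> winv y = x then 1 else 0) = (0 :: complex)" by simp
  qed
  from bmat_cmult[OF this, of c] show ?thesis
    unfolding bconv_def by (rule bmat_mono[OF bmat_cong]) auto
qed

lemma bconv1_finite:
  assumes "finite F" "F \<subseteq> free_grp S"
  shows "\<exists>D\<ge>0. bconv1 S (restr F b) D"
  using assms
proof (induction F)
  case empty
  have "bconv1 S (restr {} b) 0"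
    unfolding bconv_def by (rule bmatI) (simp add: restr_def)
  then show ?case by auto
next
  case (insert x F)
  then obtain D where D: "0 \<le> D" "bconv1 S (restr F b) D" by auto
  have "bconv1 S (restr (insert x F) b) (2 * (cmod (b x))\<^sup>2 + 2 * D)"
    unfolding bconv_def
  proof (rule bmat_cong[OF bmat_mono[OF bmat_add]])
    show "bmat 1 (free_grp S) (free_grp S) (\<lambda>i j z y. if z \<odot> winv y = x then b x else 0) ((cmod (b x))\<^sup>2)"
      using bconv1_single[of x S "b x"] insert.prems by (simp add: bconv_def)
    show "bmat 1 (free_grp S) (free_grp S) (\<lambda>i j z y. restr F b (z \<odot> winv y)) D"
      using D(2) by (simp add: bconv_def)
  qed (use insert.hyps in \<open>auto simp: restr_def\<close>)
  then show ?case using D(1) by (intro exI[of _ "2 * (cmod (b x))\<^sup>2 + 2 * D"]) auto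
qed

text \<open>The substitution \<open>y = winv x \<odot> z\<close> turns the sum over translations
  into the convolution series over columns.\<close>

lemma lreg_sum:
  assumes "finite F" "F \<subseteq> free_grp S"
  shows "(\<Sum>x\<in>F. b x * lreg (free_grp S) x f z) = conv S (restr F b) f z"
proof (cases "f \<in> l2 (free_grp S) \<and> z \<in> free_grp S")
  case True
  then have z: "z \<in> free_grp S" "reduced z" by (auto dest: free_grp_reduced)
  let ?y = "\<lambda>x. winv x \<odot> z"
  have r: "reduced x" if "x \<in> F" for x using that assms free_grp_reduced by blast
  have zy: "z \<odot> winv (?y x) = x" if "x \<in> F" for x
    using r[OF that] z by (simp add: winv_wmult reduced_winv wmult_winv_cancel)
  have inj: "inj_on ?y F" by (rule inj_onI) (metis zy)
  have "(\<Sum>\<^sub>\<infinity>y\<in>free_grp S. restr F b (z \<odot> winv y) * f y) = (\<Sum>\<^sub>\<infinity>y\<in>?y ` F. restr F b (z \<odot> winv y) * f y)"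
  proof (rule infsum_cong_neutral)
    fix y assume y: "y \<in> free_grp S - ?y ` F"
    then have "reduced y" by (auto dest: free_grp_reduced)
    have "z \<odot> winv y \<notin> F"
    proof
      assume "z \<odot> winv y \<in> F"
      moreover have "winv (z \<odot> winv y) \<odot> z = y"
        using \<open>reduced y\<close> z by (simp add: winv_wmult reduced_winv wmult_assoc winv_left wmult_Nil_right)
      ultimately show False using y by force
    qed
    then show "restr F b (z \<odot> winv y) * f y = 0" by (simp add: restr_def)
  next
    fix y assume "y \<in> ?y ` F - free_grp S"
    then show "restr F b (z \<odot> winv y) * f y = 0" using assms z by (auto simp: free_grp_closed subset_iff)
  qed simp
  also have "\<dots> = (\<Sum>x\<in>F. b x * f (?y x))"
    using assms by (simp add: sum.reindex[OF inj] zy restr_def)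
  finally show ?thesis using True by (simp add: conv_def lreg_def)
next
  case False
  then have "lreg (free_grp S) x f z = 0" for x by (auto simp: lreg_def)
  with False show ?thesis by (auto simp: conv_def)
qed

text \<open>
  The coefficient functions \<open>T (delta [])\<close> of the operators \<open>T\<close> in the reduced C*-algebra.
\<close>

definition creg :: "nat set \<Rightarrow> (word \<Rightarrow> complex) set" where
  "creg S = {a. (\<forall>x. x \<notin> free_grp S \<longrightarrow> a x = 0) \<and>
     (\<forall>\<epsilon>>0. \<exists>F b. finite F \<and> F \<subseteq> free_grp S \<and> bconv1 S (\<lambda>x. a x - restr F b x) \<epsilon>)}"

lemma creg_bconv1:
  assumes "a \<in> creg S"
  shows "\<exists>D\<ge>0. bconv1 S a D"
proof -
  obtain F b where F: "finite F" "F \<subseteq> free_grp S" "bconv1 S (\<lambda>x. a x - restr F b x) 1"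
    using assms unfolding creg_def by (auto dest: spec[of _ "1 :: real"])
  obtain D where D: "0 \<le> D" "bconv1 S (restr F b) D" using bconv1_finite F by blast
  have "bconv1 S a (2 * 1 + 2 * D)"
    using bmat_add[OF F(3)[unfolded bconv_def] D(2)[unfolded bconv_def]] unfolding bconv_def by simp
  then show ?thesis using D(1) by (intro exI[of _ "2 * 1 + 2 * D"]) auto
qed

lemma conv_combination:
  assumes "bconv1 S a D" "bconv1 S b D'"
  shows "conv S (\<lambda>x. c * a x + b x) f z = c * conv S a f z + conv S b f z"
proof (cases "f \<in> l2 (free_grp S) \<and> z \<in> free_grp S")
  case True
  then have "(\<lambda>y. a (z \<odot> winv y) * f y) summable_on free_grp S" "(\<lambda>y. b (z \<odot> winv y) * f y) summable_on free_grp S"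
    using conv_summable assms by blast+
  then show ?thesis
    using True by (simp add: conv_def distrib_right mult.assoc infsum_add summable_on_cmult_right infsum_cmult_right')
qed (auto simp: conv_def)

lemma conv_diff:
  assumes "bconv1 S a D" "bconv1 S b D'"
  shows "conv S (\<lambda>x. a x - b x) f z = conv S a f z - conv S b f z"
  using conv_combination[OF assms(2,1), of "-1" f z] by simp

lemma conv_in_Cred:
  assumes "a \<in> creg S"
  shows "conv S a \<in> Cred (free_grp S)"
proof -
  obtain D where D: "0 \<le> D" "bconv1 S a D" using creg_bconv1[OF assms] by blast
  have "\<exists>F b. finite F \<and> F \<subseteq> free_grp S \<and>
      opnorm (free_grp S) (\<lambda>f z. conv S a f z - (\<Sum>x\<in>F. b x * lreg (free_grp S) x f z)) < e" if "e > 0" for e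
  proof -
    \<comment> \<open>The square appears because \<open>bconv1\<close> bounds squared norms; the
      half secures the strict inequality.\<close>
    obtain F b where F: "finite F" "F \<subseteq> free_grp S" and cb: "bconv1 S (\<lambda>x. a x - restr F b x) ((e / 2)\<^sup>2)"
      using assms \<open>e > 0\<close> unfolding creg_def by (auto dest: spec[of _ "(e / 2)\<^sup>2"])
    obtain D' where D': "bconv1 S (restr F b) D'" using bconv1_finite F by blast
    have "opnorm (free_grp S) (\<lambda>f z. conv S a f z - (\<Sum>x\<in>F. b x * lreg (free_grp S) x f z))
      = opnorm (free_grp S) (conv S (\<lambda>x. a x - restr F b x))"
      by (simp add: lreg_sum[OF F] conv_diff[OF D(2) D', abs_def])
    also have "\<dots> \<le> sqrt ((e / 2)\<^sup>2)"
      by (intro opnorm_least conv_Bop(2)[OF cb]) auto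
    also have "\<dots> < e" using \<open>e > 0\<close> by simp
    finally show ?thesis using F by blast
  qed
  then show ?thesis using conv_Bop(1)[OF D(2,1)] by (simp add: Cred_def)
qed

text \<open>Entries of a finite combination of translations depend on
  \<open>z \<odot> winv y\<close> alone. This passes to norm limits, so column \<open>[]\<close>
  determines \<open>T\<close>.\<close>

lemma Cred_eq_conv:
  assumes "T \<in> Cred (free_grp S)"
  shows "T = conv S (T (delta []))" "T (delta []) \<in> creg S"
proof -
  let ?G = "free_grp S" and ?a = "T (delta [])"
  have T: "T \<in> Bop ?G" using assms by (simp add: Cred_def)
  have appr: "\<exists>F b X. finite F \<and> F \<subseteq> ?G \<and> X \<in> Bop ?G \<and> opnorm ?G X < e
      \<and> (\<forall>y\<in>?G. \<forall>z\<in>?G. X (delta y) z = T (delta y) z - restr F b (z \<odot> winv y))" if "e > 0" for e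
  proof -
    obtain F b where F: "finite F" "F \<subseteq> ?G" "opnorm ?G (\<lambda>f z. T f z - conv S (restr F b) f z) < e"
    proof -
      obtain F b where F: "finite F" "F \<subseteq> ?G"
        "opnorm ?G (\<lambda>f z. T f z - (\<Sum>x\<in>F. b x * lreg ?G x f z)) < e"
        using assms \<open>e > 0\<close> unfolding Cred_def by blast
      then show thesis using that[of F b] by (simp add: lreg_sum)
    qed
    obtain D where "0 \<le> D" "bconv1 S (restr F b) D" using bconv1_finite F by blast
    then have "(\<lambda>f z. T f z - conv S (restr F b) f z) \<in> Bop ?G"
      by (intro Bop_diff T conv_Bop)
    then show ?thesis using F by (intro exI[of _ F] exI[of _ b] exI conjI) (auto simp: conv_delta)
  qed
  have delta: "T (delta y) z = ?a (z \<odot> winv y)" if yz: "y \<in> ?G" "z \<in> ?G" for y z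
  proof -
    have "cmod (T (delta y) z - ?a (z \<odot> winv y)) \<le> e" if e: "e > 0" for e
    proof -
      obtain F b X where X: "X \<in> Bop ?G" "opnorm ?G X < e / 2"
        and Xd: "\<And>y z. y \<in> ?G \<Longrightarrow> z \<in> ?G \<Longrightarrow> X (delta y) z = T (delta y) z - restr F b (z \<odot> winv y)"
        using appr[of "e / 2"] e by auto
      have le: "cmod (X (delta y) z) \<le> e / 2" if "y \<in> ?G" "z \<in> ?G" for y z
        using l2_point_le[OF Bop_l2[OF X(1) delta_l2[OF that(1)]] that(2)] opnorm_upper[OF X(1) delta_l2[OF that(1)]]
          delta_l2norm[OF that(1)] X(2) by simp
      let ?v = "z \<odot> winv y"
      have v: "?v \<in> ?G" "?v \<odot> winv [] = ?v"
        using yz by (simp_all add: free_grp_closed winv_Nil wmult_Nil_right reduced_wmult reduced_winv free_grp_reduced)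
      \<comment> \<open>The approximant has equal entries at these two places and cancels, leaving
        two small entries of the error \<open>X\<close>.\<close>
      have "T (delta y) z - ?a ?v = X (delta y) z - X (delta []) ?v"
        using yz v by (simp add: Xd)
      also have "cmod \<dots> \<le> e / 2 + e / 2"
        using le yz v by (intro norm_triangle_le_diff add_mono) auto
      finally show ?thesis by simp
    qed
    then have "cmod (T (delta y) z - ?a (z \<odot> winv y)) \<le> 0"
      by (rule field_le_epsilon) simp
    then show ?thesis by simp
  qed
  show "T = conv S ?a" by (rule Bop_eq_conv[OF T delta])
  have "\<exists>F b. finite F \<and> F \<subseteq> ?G \<and> bconv1 S (\<lambda>x. ?a x - restr F b x) \<epsilon>" if e: "\<epsilon> > 0" for \<epsilon>
  proof -
    obtain F b X where F: "finite F" "F \<subseteq> ?G" and X: "X \<in> Bop ?G" "opnorm ?G X < sqrt \<epsilon>"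
      and Xd: "\<And>y z. y \<in> ?G \<Longrightarrow> z \<in> ?G \<Longrightarrow> X (delta y) z = T (delta y) z - restr F b (z \<odot> winv y)"
      using appr[of "sqrt \<epsilon>"] e by auto
    have "bconv1 S (\<lambda>x. ?a x - restr F b x) \<epsilon>"
    proof (rule Bop_bconv1[OF X(1)])
      fix f assume f: "f \<in> l2 ?G"
      have "l2norm ?G (X f) \<le> sqrt \<epsilon> * l2norm ?G f"
        using opnorm_upper[OF X(1) f] mult_right_mono[OF less_imp_le[OF X(2)], of "l2norm ?G f"] by simp
      then have "(l2norm ?G (X f))\<^sup>2 \<le> (sqrt \<epsilon> * l2norm ?G f)\<^sup>2" by (intro power_mono) auto
      then show "(l2norm ?G (X f))\<^sup>2 \<le> \<epsilon> * (l2norm ?G f)\<^sup>2"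
        using e by (simp add: power_mult_distrib)
    qed (simp add: Xd delta)
    then show ?thesis using F by blast
  qed
  moreover have "?a x = 0" if "x \<notin> ?G" for x
    using l2_outside[OF Bop_l2[OF T delta_l2]] that by simp
  ultimately show "?a \<in> creg S" by (simp add: creg_def)
qed

lemma conv_delta_Nil:
  assumes "a \<in> creg S"
  shows "conv S a (delta []) = a"
proof
  fix z
  show "conv S a (delta []) z = a z"
  proof (cases "z \<in> free_grp S")
    case True
    then show ?thesis
      by (simp add: conv_delta winv_def wmult_Nil_right free_grp_reduced)
  qed (use assms in \<open>auto simp: conv_outside creg_def\<close>)
qed

section \<open>The complete isomorphism\<close>

definition transfer :: "nat set \<Rightarrow> nat set \<Rightarrow> (word \<Rightarrow> complex) \<Rightarrow> word \<Rightarrow> complex" where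
  "transfer S T a x = (if x \<in> free_grp T then a (rho S T x) else 0)"

lemma bconv_cong:
  assumes "bconv S k a D" "\<And>i j x. x \<in> free_grp S \<Longrightarrow> a i j x = b i j x"
  shows "bconv S k b D"
  using assms(1) unfolding bconv_def by (rule bmat_cong) (simp add: assms(2) free_grp_closed)

lemma bconv_transfer:
  assumes "{0, 1} \<subseteq> S" "{0, 1} \<subseteq> T" "0 \<le> D" "bconv S k a D"
  shows "bconv T k (\<lambda>i j. transfer S T (a i j)) (1456 * D)"
  using bconv_rho[OF assms] by (rule bconv_cong) (simp add: transfer_def)

text \<open>Since \<open>rho S T\<close> is a bijection, finite supports pull back to finite
  supports, and the error grows at most by the factor 1456.\<close>

lemma transfer_creg:
  assumes S: "{0, 1} \<subseteq> S" and T: "{0, 1} \<subseteq> T" and a: "a \<in> creg S"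
  shows "transfer S T a \<in> creg T"
proof -
  have "\<exists>F b. finite F \<and> F \<subseteq> free_grp T \<and> bconv1 T (\<lambda>x. transfer S T a x - restr F b x) \<epsilon>" if e: "\<epsilon> > 0" for \<epsilon>
  proof -
    have e': "0 < \<epsilon> / 1456" using e by simp
    then obtain F b where F: "finite F" "F \<subseteq> free_grp S" "bconv1 S (\<lambda>x. a x - restr F b x) (\<epsilon> / 1456)"
      using a unfolding creg_def by blast
    define F' where "F' = {x \<in> free_grp T. rho S T x \<in> F}"
    have "inj_on (rho S T) F'"
      using rho_bij[OF S T] by (auto simp: F'_def bij_betw_def inj_on_def)
    moreover have "rho S T ` F' \<subseteq> F" by (auto simp: F'_def)
    ultimately have "finite F'" using F(1) finite_subset inj_on_finite by blast
    moreover have "bconv1 T (transfer S T (\<lambda>x. a x - restr F b x)) (1456 * (\<epsilon> / 1456))"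
      using e F(3) by (intro bconv_transfer S T) auto
    then have "bconv1 T (\<lambda>x. transfer S T a x - restr F' (\<lambda>x. b (rho S T x)) x) \<epsilon>"
      by (simp, elim bconv_cong) (auto simp: transfer_def restr_def F'_def)
    ultimately show ?thesis by (intro exI[of _ F']) (auto simp: F'_def)
  qed
  then show ?thesis by (simp add: creg_def transfer_def)
qed

lemma transfer_transfer:
  assumes S: "{0, 1} \<subseteq> S" and T: "{0, 1} \<subseteq> T" and a: "a \<in> creg S"
  shows "transfer T S (transfer S T a) = a"
proof
  fix x
  show "transfer T S (transfer S T a) x = a x"
    using a rho_rho[OF T S, of x] bij_betw_apply[OF rho_bij[OF T S], of x] by (auto simp: transfer_def creg_def)
qed

definition cred_map :: "nat set \<Rightarrow> nat set \<Rightarrow> op \<Rightarrow> op" where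
  "cred_map S T X = conv T (transfer S T (X (delta [])))"

lemma cred_map_in_Cred:
  assumes "{0, 1} \<subseteq> S" "{0, 1} \<subseteq> T" "X \<in> Cred (free_grp S)"
  shows "cred_map S T X \<in> Cred (free_grp T)"
  unfolding cred_map_def by (intro conv_in_Cred transfer_creg Cred_eq_conv assms)

lemma cred_map_cred_map:
  assumes "{0, 1} \<subseteq> S" "{0, 1} \<subseteq> T" "X \<in> Cred (free_grp S)"
  shows "cred_map T S (cred_map S T X) = X"
  using Cred_eq_conv[OF assms(3)] assms
  by (simp add: cred_map_def conv_delta_Nil transfer_creg transfer_transfer)

lemma cred_map_linear:
  assumes S: "{0, 1} \<subseteq> S" and T: "{0, 1} \<subseteq> T"
  shows "lin_on (Cred (free_grp S)) (cred_map S T)"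
  unfolding lin_on_def
proof (intro ballI allI)
  fix X Y and c :: complex
  assume X: "X \<in> Cred (free_grp S)" and Y: "Y \<in> Cred (free_grp S)"
  let ?a = "transfer S T (X (delta []))" and ?b = "transfer S T (Y (delta []))"
  obtain D D' where D: "bconv1 T ?a D" "bconv1 T ?b D'"
    using creg_bconv1 transfer_creg[OF S T] Cred_eq_conv(2) X Y by meson
  have "transfer S T (\<lambda>x. c * X (delta []) x + Y (delta []) x) = (\<lambda>x. c * ?a x + ?b x)"
    by (auto simp: transfer_def)
  then show "cred_map S T (\<lambda>f x. c * X f x + Y f x) = (\<lambda>f x. c * cred_map S T X f x + cred_map S T Y f x)"
    by (intro ext) (simp add: cred_map_def conv_combination[OF D])
qed

text \<open>A crude bound growing with \<open>k\<close>: one factor \<open>k\<close> from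
  Cauchy-Schwarz over columns, one from the rows. It supplies the finiteness that
  \<open>matnorm_conv\<close> asks for and does not enter the final constant.\<close>

lemma bconv_of_entries:
  assumes "\<And>i j. i < k \<Longrightarrow> j < k \<Longrightarrow> \<exists>D\<ge>0. bconv1 S (a i j) D"
  shows "\<exists>D\<ge>0. bconv S k a D"
proof -
  obtain d where d: "\<And>i j. i < k \<Longrightarrow> j < k \<Longrightarrow> 0 \<le> d i j \<and> bconv1 S (a i j) (d i j)"
    using assms by metis
  let ?D = "\<Sum>i<k. \<Sum>j<k. d i j"
  have D: "0 \<le> ?D" by (intro sum_nonneg) (use d in auto)
  have "bconv S k a (real k * (real k * ?D))"
    unfolding bconv_def
  proof (rule bmatI)
    fix F E and f :: "word \<Rightarrow> nat \<Rightarrow> complex"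
    assume *: "finite F" "F \<subseteq> free_grp S" "finite E" "E \<subseteq> free_grp S"
    let ?X = "\<lambda>p i j. \<Sum>q\<in>E. a i j (p \<odot> winv q) * f q j"
    let ?N = "\<Sum>q\<in>E. \<Sum>j<k. (cmod (f q j))\<^sup>2"
    have X: "(\<Sum>p\<in>F. (cmod (?X p i j))\<^sup>2) \<le> ?D * (\<Sum>q\<in>E. (cmod (f q j))\<^sup>2)" if "i < k" "j < k" for i j
    proof -
      have "(\<Sum>p\<in>F. (cmod (?X p i j))\<^sup>2) \<le> d i j * (\<Sum>q\<in>E. (cmod (f q j))\<^sup>2)"
        using bmatD[OF d[OF that, THEN conjunct2, unfolded bconv_def] *, of "\<lambda>q _. f q j"] by simp
      also have "d i j \<le> (\<Sum>j<k. d i j)"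
        using d that by (intro member_le_sum) auto
      also have "\<dots> \<le> ?D"
        using d that by (intro member_le_sum[where f = "\<lambda>i. \<Sum>j<k. d i j"] sum_nonneg) auto
      finally show ?thesis by (simp add: mult_right_mono sum_nonneg)
    qed
    have "(\<Sum>p\<in>F. \<Sum>i<k. (cmod (\<Sum>q\<in>E. \<Sum>j<k. a i j (p \<odot> winv q) * f q j))\<^sup>2)
        = (\<Sum>p\<in>F. \<Sum>i<k. (cmod (\<Sum>j<k. ?X p i j))\<^sup>2)"
      by (simp add: sum.swap[of _ _ E])
    also have "\<dots> \<le> (\<Sum>p\<in>F. \<Sum>i<k. real k * (\<Sum>j<k. (cmod (?X p i j))\<^sup>2))"
    proof (intro sum_mono)
      fix p i
      have "(cmod (\<Sum>j<k. ?X p i j))\<^sup>2 \<le> (\<Sum>j<k. cmod (?X p i j))\<^sup>2"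
        by (intro power_mono norm_sum) auto
      also have "\<dots> \<le> real k * (\<Sum>j<k. (cmod (?X p i j))\<^sup>2)"
        using sum_squared_le_sum_of_squares[of "\<lambda>j. cmod (?X p i j)" "{..<k}"] by (simp add: mult.commute)
      finally show "(cmod (\<Sum>j<k. ?X p i j))\<^sup>2 \<le> real k * (\<Sum>j<k. (cmod (?X p i j))\<^sup>2)" .
    qed
    also have "\<dots> = real k * (\<Sum>i<k. \<Sum>j<k. \<Sum>p\<in>F. (cmod (?X p i j))\<^sup>2)"
      by (simp add: sum_distrib_left sum.swap[of _ _ F])
    also have "\<dots> \<le> real k * (\<Sum>i<k. \<Sum>j<k. ?D * (\<Sum>q\<in>E. (cmod (f q j))\<^sup>2))"
      using X by (intro mult_left_mono sum_mono) auto
    also have "\<dots> = real k * (real k * ?D) * ?N"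
      by (simp add: sum_distrib_left[symmetric] sum.swap[of _ _ E])
    finally show "(\<Sum>p\<in>F. \<Sum>i<k. (cmod (\<Sum>q\<in>E. \<Sum>j<k. a i j (p \<odot> winv q) * f q j))\<^sup>2)
        \<le> real k * (real k * ?D) * ?N" .
  qed
  then show ?thesis using D by (intro exI[of _ "real k * (real k * ?D)"]) simp
qed

text \<open>The matrix norm N yields the coefficient bound N^2, transfer multiplies it by 1456, and
  the square root bounds the new matrix norm uniformly in \<open>k\<close>.\<close>

lemma cred_map_cbounded:
  assumes S: "{0, 1} \<subseteq> S" and T: "{0, 1} \<subseteq> T"
  shows "cbounded (free_grp S) (free_grp T) (cred_map S T)"
  unfolding cbounded_def
proof (intro exI[of _ "sqrt 1456"] allI impI)
  fix k and M :: "nat \<Rightarrow> nat \<Rightarrow> op"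
  assume M: "\<forall>i<k. \<forall>j<k. M i j \<in> Cred (free_grp S)"
  let ?a = "\<lambda>i j. M i j (delta [])"
  let ?N = "matnorm (free_grp S) k M"
  have N: "?N = matnorm (free_grp S) k (\<lambda>i j. conv S (?a i j))"
    using M by (intro matnorm_cong Cred_eq_conv(1)) auto
  obtain D where D: "bconv S k ?a D" "0 \<le> D"
    using bconv_of_entries[of k S ?a] creg_bconv1 Cred_eq_conv(2) M by blast
  note Na = matnorm_conv[OF D, folded N]
  have "matnorm (free_grp T) k (\<lambda>i j. cred_map S T (M i j)) \<le> sqrt (1456 * ?N\<^sup>2)"
    unfolding cred_map_def by (intro matnorm_conv_le bconv_transfer[OF S T _ Na(2)]) auto
  also have "\<dots> = sqrt 1456 * ?N" using Na(1) by (simp add: real_sqrt_mult)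
  finally show "matnorm (free_grp T) k (\<lambda>i j. cred_map S T (M i j)) \<le> sqrt 1456 * ?N" .
qed

theorem theorem2:
  fixes n :: nat
  assumes "n \<ge> 2"
  shows "\<exists>u. lin_on (Cred (F_fin n)) u \<and> bij_betw u (Cred (F_fin n)) (Cred F_inf)
            \<and> cbounded (F_fin n) F_inf u
            \<and> cbounded F_inf (F_fin n) (inv_into (Cred (F_fin n)) u)"
proof -
  have S: "{0, 1} \<subseteq> {..<n}" and T: "{0, 1} \<subseteq> (UNIV :: nat set)"
    using assms by auto
  let ?u = "cred_map {..<n} UNIV" and ?v = "cred_map UNIV {..<n}"
  have bij: "bij_betw ?u (Cred (F_fin n)) (Cred F_inf)"
    by (rule bij_betwI[where g = ?v])
      (auto simp: cred_map_in_Cred[OF S T] cred_map_in_Cred[OF T S] cred_map_cred_map[OF S T] cred_map_cred_map[OF T S])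
  have inv: "inv_into (Cred (F_fin n)) ?u Y = ?v Y" if "Y \<in> Cred F_inf" for Y
    using that bij by (intro inv_into_f_eq) (auto simp: bij_betw_def cred_map_in_Cred[OF T S] cred_map_cred_map[OF T S])
  have "cbounded F_inf (F_fin n) (inv_into (Cred (F_fin n)) ?u)"
  proof -
    \<comment> \<open>The inverse agrees with \<open>?v\<close> on the algebra alone; this suffices
      because \<open>matnorm\<close> reads the entries with indices below \<open>k\<close>.\<close>
    have "matnorm (F_fin n) k (\<lambda>i j. inv_into (Cred (F_fin n)) ?u (M i j)) = matnorm (F_fin n) k (\<lambda>i j. ?v (M i j))"
      if "\<forall>i<k. \<forall>j<k. M i j \<in> Cred F_inf" for k M
      using that inv by (intro matnorm_cong) auto
    then show ?thesis
      using cred_map_cbounded[OF T S] unfolding cbounded_def by simp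
  qed
  then show ?thesis
    using cred_map_linear[OF S T] bij cred_map_cbounded[OF S T] by blast
qed

end
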